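(* Let $K,N\ge 1$ and $M\ge KN$ be integers, and let $\mathbf H\in\mathbb C^{KN\times M}$ have i.i.d. circularly-symmetric complex Gaussian entries of zero mean and unit variance. Define $\beta_{\mathrm{DPC\text{-}ZF}}(\mathbf H)=\lim_{P\to\infty}\left[\mathcal C_{\mathrm{DPC}}(\mathbf H,P)-\mathcal C_{\mathrm{ZF}}(\mathbf H,P)\right]$ and $\bar\beta_{\mathrm{DPC\text{-}ZF}}(M,KN)=\mathbb E_{\mathbf H}[\beta_{\mathrm{DPC\text{-}ZF}}(\mathbf H)]$. Then $$\bar\beta_{\mathrm{DPC\text{-}ZF}}(M,KN)=\log_2 e\sum_{j=1}^{KN-1}\frac{j}{M-j}\quad\text{(bits/s/Hz)}.$$
   Context: MIMO broadcast channel: a transmitter with $M$ antennas and $K$ users, each with $N$ antennas; user $k$ has channel $\mathbf H_k\in\mathbb C^{N\times M}$, and $\mathbf H$ is the $KN\times M$ matrix obtained by stacking $\mathbf H_1,\dots,\mathbf H_K$; its rows are denoted $\mathbf h_{k,n}$ ($n$-th row of $\mathbf H_k$). Noise is unit-variance, and $P$ is the total transmit power. The dirty-paper-coding sum capacity is $\mathcal C_{\mathrm{DPC}}(\mathbf H,P)=\max\log_2\left|\mathbf I+\sum_{k=1}^K\mathbf H_k^H\mathbf Q_k\mathbf H_k\right|$, the maximum over positive semidefinite $N\times N$ matrices $\mathbf Q_1,\dots,\mathbf Q_K$ with $\sum_k\mathrm{tr}(\mathbf Q_k)\le P$. Zero-forcing: for each row $\mathbf h_{k,n}$, let $g_{k,n}$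 satisfy $|g_{k,n}|=$ the Euclidean norm of the orthogonal projection of $\mathbf h_{k,n}$ onto the orthogonal complement of the span of the other $KN-1$ rows of $\mathbf H$ (equivalently $g_{k,n}=\mathbf h_{k,n}\mathbf v_{k,n}$ for the unit-norm vector $\mathbf v_{k,n}$ in that direction, orthogonal to all other rows). The zero-forcing sum rate is $\mathcal C_{\mathrm{ZF}}(\mathbf H,P)=\max_{P_{k,n}\ge0,\ \sum_{k,n}P_{k,n}\le P}\sum_{k=1}^K\sum_{n=1}^N\log_2(1+P_{k,n}|g_{k,n}|^2)$. ($\mathbf H$ has full row rank with probability one.) *)

theory Defs
  imports "HOL-Probability.Probability" "Jordan_Normal_Form.Determinant"
begin

text \<open>Conventions. The stacked channel matrix H (KN x M) is a function on index pairs: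
  H (i, a) is the entry in row i < K*N and column a < M. Row n of the user block H_k
  (k < K, n < N) is row k*N + n of H (stacking H_1,...,H_K). Indices are 0-based.\<close>

definition complex_gaussian :: "complex measure" where
  "complex_gaussian = density lborel (\<lambda>z. ennreal (exp (- (cmod z)\<^sup>2) / pi))"

definition channel_distr :: "nat \<Rightarrow> nat \<Rightarrow> nat \<Rightarrow> (nat \<times> nat \<Rightarrow> complex) measure" where
  "channel_distr K N M = PiM ({..<K*N} \<times> {..<M}) (\<lambda>_. complex_gaussian)"

definition psd :: "nat \<Rightarrow> (nat \<Rightarrow> nat \<Rightarrow> complex) \<Rightarrow> bool" where
  "psd N Q \<longleftrightarrow> (\<forall>i<N. \<forall>j<N. Q j i = cnj (Q i j)) \<and>
     (\<forall>x :: nat \<Rightarrow> complex. 0 \<le> Re (\<Sum>i<N. \<Sum>j<N. cnj (x i) * Q i j * x j))"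

definition dpc_matrix :: "nat \<Rightarrow> nat \<Rightarrow> nat \<Rightarrow> (nat \<times> nat \<Rightarrow> complex)
    \<Rightarrow> (nat \<Rightarrow> nat \<Rightarrow> nat \<Rightarrow> complex) \<Rightarrow> complex mat" where
  "dpc_matrix K N M H Q = mat M M (\<lambda>(a, b).
     (if a = b then 1 else 0) +
     (\<Sum>k<K. \<Sum>n<N. \<Sum>n'<N. cnj (H (k*N + n, a)) * Q k n n' * H (k*N + n', b)))"

definition C_DPC :: "nat \<Rightarrow> nat \<Rightarrow> nat \<Rightarrow> (nat \<times> nat \<Rightarrow> complex) \<Rightarrow> real \<Rightarrow> real" where
  "C_DPC K N M H P = Sup {log 2 (Re (det (dpc_matrix K N M H Q))) | Q.
      (\<forall>k<K. psd N (Q k)) \<and> Re (\<Sum>k<K. \<Sum>n<N. Q k n n) \<le> P}"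

text \<open>Orthogonal projection of row i of H onto the orthogonal complement of the span of the
  other rows: the unique vector p (supported on columns < M) with h_i - p in the span of the
  rows h_j, j \<noteq> i, and p orthogonal to every such row.\<close>
definition zf_proj :: "nat \<Rightarrow> nat \<Rightarrow> (nat \<times> nat \<Rightarrow> complex) \<Rightarrow> nat \<Rightarrow> (nat \<Rightarrow> complex)" where
  "zf_proj R M H i = (THE p. (\<forall>a. a \<ge> M \<longrightarrow> p a = 0) \<and>
      (\<exists>c :: nat \<Rightarrow> complex. \<forall>a<M. H (i, a) - p a = (\<Sum>j\<in>{..<R} - {i}. c j * H (j, a))) \<and>
      (\<forall>j\<in>{..<R} - {i}. (\<Sum>a<M. p a * cnj (H (j, a))) = 0))"

definition zf_gain :: "nat \<Rightarrow> nat \<Rightarrow> (nat \<times> nat \<Rightarrow> complex) \<Rightarrow> nat \<Rightarrow> real" where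
  "zf_gain R M H i = sqrt (\<Sum>a<M. (cmod (zf_proj R M H i a))\<^sup>2)"

definition C_ZF :: "nat \<Rightarrow> nat \<Rightarrow> nat \<Rightarrow> (nat \<times> nat \<Rightarrow> complex) \<Rightarrow> real \<Rightarrow> real" where
  "C_ZF K N M H P = Sup {(\<Sum>k<K. \<Sum>n<N. log 2 (1 + Pw k n * (zf_gain (K*N) M H (k*N + n))\<^sup>2)) | Pw.
      (\<forall>k<K. \<forall>n<N. 0 \<le> Pw k n) \<and> (\<Sum>k<K. \<Sum>n<N. Pw k n) \<le> P}"

end

theory Submission
  imports Defs "HOL-Real_Asymp.Real_Asymp" "Jordan_Normal_Form.Schur_Decomposition"
begin

text \<open>
  Write \<open>R = K N\<close>, let \<open>G\<close> be the Gram matrix of the rows of \<open>H\<close> and \<open>G\<^sub>i\<close> that of the rows other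
  than \<open>i\<close>. For large \<open>P\<close> equal power allocation is asymptotically optimal for both schemes:
  \<open>C_DPC = R log (P / R) + log (det G) + o(1)\<close>, by Sylvester's identity
  \<open>det (1 + H\<^sup>* Q H) = det (G\<^sup>-\<^sup>1 + Q) det G\<close> and AM-GM on eigenvalues, and
  \<open>C_ZF = R log (P / R) + \<Sum>i. log (det G / det G\<^sub>i) + o(1)\<close>, since the squared gain of row \<open>i\<close> is
  \<open>1 / (G\<^sup>-\<^sup>1)\<^sub>i\<^sub>i\<close>.

  For the expectation, Givens rotations preserve the Gaussian law and triangularise the first
  \<open>m\<close> rows. Hence \<open>det G\<close> of \<open>m + 1\<close> rows has the law of \<open>det G\<close> of \<open>m\<close> rows times an independent
  sum of \<open>M - m\<close> standard exponential variables, so that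
  \<open>E (ln (det G)) = \<Sum>m<R. \<psi> (M - m)\<close>. The claim follows from \<open>\<psi> (n + 1) = \<psi> n + 1 / n\<close>.
\<close>

subsection \<open>The complex Gaussian measure\<close>

text \<open>Why the answer is a finite sum: the term \<open>R log (P / R)\<close> cancels, and since
  the rows are exchangeable every ratio \<open>det G / det G\<^sub>i\<close> has the same mean
  logarithm \<psi>(M - R + 1). Up to the factor log_2 e the gap is the sum over m < R of \<psi>(M -
  m) - \<psi>(M - R + 1), in which the increment 1 / (M - j) of \<psi> is counted j times. The
  obstacle in the probabilistic half is that the triangularising rotation depends on the rows it
  triangularises. The law of the determinant is therefore built one row at a time: Fubini freezes
  the earlier rows, and for each choice of them one fixed rotation acts on the fresh row. Invariance
  of Lebesgue measure under a planar rotation is reduced to translations by writing the rotation as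
  shears. In the deterministic half both upper bounds have the form c + R log ((D + P) / R), where D
  depends on H only and disappears in the limit.\<close>

lemma nn_integral_lborel_translate:
  fixes f :: "'a::euclidean_space \<Rightarrow> ennreal"
  assumes [measurable]: "f \<in> borel_measurable borel"
  shows "(\<integral>\<^sup>+u. f (u + c) \<partial>lborel) = (\<integral>\<^sup>+u. f u \<partial>lborel)"
proof -
  have "(\<integral>\<^sup>+u. f u \<partial>lborel) = (\<integral>\<^sup>+u. f u \<partial>(distr lborel borel ((+) c)))"
    by (simp add: lborel_distr_plus)
  also have "\<dots> = (\<integral>\<^sup>+u. f (c + u) \<partial>lborel)"
    by (subst nn_integral_distr) auto
  finally show ?thesis by (simp add: add.commute)
qed

lemma nn_integral_shear_fst:
  fixes F :: "complex \<Rightarrow> complex \<Rightarrow> ennreal"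
  assumes [measurable]: "(\<lambda>(u, v). F u v) \<in> borel_measurable (borel \<Otimes>\<^sub>M borel)"
  shows "(\<integral>\<^sup>+u. \<integral>\<^sup>+v. F (u + c * v) v \<partial>lborel \<partial>lborel) = (\<integral>\<^sup>+u. \<integral>\<^sup>+v. F u v \<partial>lborel \<partial>lborel)"
proof -
  \<comment> \<open>With \<open>u\<close> as the inner variable, \<open>c * v\<close> is a constant
    and the shear is a translation.\<close>
  have "(\<integral>\<^sup>+u. \<integral>\<^sup>+v. F (u + c * v) v \<partial>lborel \<partial>lborel) = (\<integral>\<^sup>+v. \<integral>\<^sup>+u. F (u + c * v) v \<partial>lborel \<partial>lborel)"
    by (rule lborel_pair.Fubini') measurable
  also have "\<dots> = (\<integral>\<^sup>+v. \<integral>\<^sup>+u. F u v \<partial>lborel \<partial>lborel)"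
    by (intro nn_integral_cong nn_integral_lborel_translate) measurable
  also have "\<dots> = (\<integral>\<^sup>+u. \<integral>\<^sup>+v. F u v \<partial>lborel \<partial>lborel)"
    by (rule lborel_pair.Fubini'[symmetric]) measurable
  finally show ?thesis .
qed

lemma nn_integral_shear_snd:
  fixes F :: "complex \<Rightarrow> complex \<Rightarrow> ennreal"
  assumes [measurable]: "(\<lambda>(u, v). F u v) \<in> borel_measurable (borel \<Otimes>\<^sub>M borel)"
  shows "(\<integral>\<^sup>+u. \<integral>\<^sup>+v. F u (v + c * u) \<partial>lborel \<partial>lborel) = (\<integral>\<^sup>+u. \<integral>\<^sup>+v. F u v \<partial>lborel \<partial>lborel)"
  by (intro nn_integral_cong nn_integral_lborel_translate) measurable

text \<open>A rotation with nonzero off-diagonal entry is a product of three shears.\<close>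

lemma nn_integral_rotation:
  fixes F :: "complex \<Rightarrow> complex \<Rightarrow> ennreal"
  assumes F[measurable]: "(\<lambda>(u, v). F u v) \<in> borel_measurable (borel \<Otimes>\<^sub>M borel)"
    and cs: "c * cnj c + s * cnj s = 1" and s: "s \<noteq> 0"
  shows "(\<integral>\<^sup>+u. \<integral>\<^sup>+v. F (cnj c * u + cnj s * v) (c * v - s * u) \<partial>lborel \<partial>lborel)
    = (\<integral>\<^sup>+u. \<integral>\<^sup>+v. F u v \<partial>lborel \<partial>lborel)"
proof -
  \<comment> \<open>The upper shear by \<open>y\<close>, then the lower shear by \<open>- s\<close>,
    then the upper shear by \<open>x\<close> compose to a matrix with diagonal
    \<open>1 - s * x\<close>, \<open>1 - s * y\<close> and lower left entry \<open>- s\<close>.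
    Matching the diagonal of the rotation fixes \<open>x\<close> and \<open>y\<close>; since all
    determinants are one, the last entry then agrees too.\<close>
  define x y where "x = (1 - cnj c) / s" and "y = (1 - c) / s"
  have 1: "s * x = 1 - cnj c" "s * y = 1 - c" using s by (simp_all add: x_def y_def)
  have "s * (x + y - s * x * y) = s * x + s * y - (s * x) * (s * y)" by (simp add: algebra_simps)
  also have "\<dots> = s * cnj s" unfolding 1 using cs by (simp add: algebra_simps)
  finally have 2: "x + y - s * x * y = cnj s" using s by simp
  have e1: "cnj c * u + cnj s * v = (u + y * v) + x * (v + (- s) * (u + y * v))" for u v
  proof -
    have "(u + y * v) + x * (v + (- s) * (u + y * v)) = (1 - s * x) * u + (x + y - s * x * y) * v"
      by (simp add: algebra_simps)
    then show ?thesis using 1 2 by simp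
  qed
  have e2: "c * v - s * u = v + (- s) * (u + y * v)" for u v
  proof -
    have "v + (- s) * (u + y * v) = (1 - s * y) * v - s * u" by (simp add: algebra_simps)
    then show ?thesis using 1 by simp
  qed
  have "(\<integral>\<^sup>+u. \<integral>\<^sup>+v. F (cnj c * u + cnj s * v) (c * v - s * u) \<partial>lborel \<partial>lborel)
      = (\<integral>\<^sup>+u. \<integral>\<^sup>+v. (\<lambda>u v. F (u + x * (v + (- s) * u)) (v + (- s) * u)) (u + y * v) v \<partial>lborel \<partial>lborel)"
    by (simp only: e1 e2)
  also have "\<dots> = (\<integral>\<^sup>+u. \<integral>\<^sup>+v. (\<lambda>u v. F (u + x * v) v) u (v + (- s) * u) \<partial>lborel \<partial>lborel)"
    by (rule nn_integral_shear_fst) measurable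
  also have "\<dots> = (\<integral>\<^sup>+u. \<integral>\<^sup>+v. F (u + x * v) v \<partial>lborel \<partial>lborel)"
    by (rule nn_integral_shear_snd) measurable
  also have "\<dots> = (\<integral>\<^sup>+u. \<integral>\<^sup>+v. F u v \<partial>lborel \<partial>lborel)"
    by (rule nn_integral_shear_fst) measurable
  finally show ?thesis .
qed

lemma sets_complex_gaussian[measurable_cong, simp]: "sets complex_gaussian = sets borel"
  by (simp add: complex_gaussian_def)

lemma space_complex_gaussian[simp]: "space complex_gaussian = UNIV"
  by (simp add: complex_gaussian_def)

lemma rotation_norm:
  fixes c s :: complex
  assumes "c * cnj c + s * cnj s = 1"
  shows "(cmod (cnj c * u + cnj s * v))\<^sup>2 + (cmod (c * v - s * u))\<^sup>2 = (cmod u)\<^sup>2 + (cmod v)\<^sup>2"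
proof -
  have "complex_of_real ((cmod (cnj c * u + cnj s * v))\<^sup>2 + (cmod (c * v - s * u))\<^sup>2)
    = (c * cnj c + s * cnj s) * (u * cnj u + v * cnj v)"
    by (simp only: of_real_add complex_norm_square) (simp add: algebra_simps)
  also have "\<dots> = complex_of_real ((cmod u)\<^sup>2 + (cmod v)\<^sup>2)"
    using assms by (simp only: of_real_add complex_norm_square mult_1)
  finally show ?thesis by (simp only: of_real_eq_iff)
qed

text \<open>The joint density depends on the pair only through
  \<open>(cmod u)\<^sup>2 + (cmod v)\<^sup>2\<close>, which the rotation preserves, so the
  invariance of Lebesgue measure carries over.\<close>

lemma nn_integral_gaussian_rotation:
  fixes F :: "complex \<Rightarrow> complex \<Rightarrow> ennreal"
  assumes F[measurable]: "(\<lambda>(u, v). F u v) \<in> borel_measurable (borel \<Otimes>\<^sub>M borel)"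
    and cs: "c * cnj c + s * cnj s = 1" and s: "s \<noteq> 0"
  shows "(\<integral>\<^sup>+u. \<integral>\<^sup>+v. F (cnj c * u + cnj s * v) (c * v - s * u) \<partial>complex_gaussian \<partial>complex_gaussian)
    = (\<integral>\<^sup>+u. \<integral>\<^sup>+v. F u v \<partial>complex_gaussian \<partial>complex_gaussian)"
proof -
  define d where "d z = exp (- (cmod z)\<^sup>2) / pi" for z
  have d[measurable]: "d \<in> borel_measurable borel" unfolding d_def by measurable
  have d0: "d z \<ge> 0" for z by (simp add: d_def)
  have dd: "complex_gaussian = density lborel (\<lambda>z. ennreal (d z))"
    by (simp add: complex_gaussian_def d_def)
  have eq: "(\<integral>\<^sup>+u. \<integral>\<^sup>+v. G u v \<partial>complex_gaussian \<partial>complex_gaussian)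
      = (\<integral>\<^sup>+u. \<integral>\<^sup>+v. ennreal (d u * d v) * G u v \<partial>lborel \<partial>lborel)"
    if [measurable]: "(\<lambda>(u, v). G u v) \<in> borel_measurable (borel \<Otimes>\<^sub>M borel)" for G
    unfolding dd
    by (simp add: nn_integral_density nn_integral_cmult[symmetric] ennreal_mult d0 ac_simps)
  have inv: "d (cnj c * u + cnj s * v) * d (c * v - s * u) = d u * d v" for u v
    using rotation_norm[OF cs, of u v] by (simp add: d_def exp_add[symmetric] algebra_simps)
  have "(\<integral>\<^sup>+u. \<integral>\<^sup>+v. F (cnj c * u + cnj s * v) (c * v - s * u) \<partial>complex_gaussian \<partial>complex_gaussian)
    = (\<integral>\<^sup>+u. \<integral>\<^sup>+v. (\<lambda>u v. ennreal (d u * d v) * F u v) (cnj c * u + cnj s * v) (c * v - s * u) \<partial>lborel \<partial>lborel)"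
    by (subst eq) (simp_all add: inv)
  also have "\<dots> = (\<integral>\<^sup>+u. \<integral>\<^sup>+v. ennreal (d u * d v) * F u v \<partial>lborel \<partial>lborel)"
    by (rule nn_integral_rotation[OF _ cs s]) measurable
  also have "\<dots> = (\<integral>\<^sup>+u. \<integral>\<^sup>+v. F u v \<partial>complex_gaussian \<partial>complex_gaussian)"
    by (subst eq) simp_all
  finally show ?thesis .
qed

section \<open>Exponential law of the squared modulus\<close>

lemma emeasure_norm_square_le:
  assumes "s \<ge> 0"
  shows "emeasure lborel {z::complex. (cmod z)\<^sup>2 \<le> s} = ennreal (pi * s)"
proof -
  have "{z::complex. (cmod z)\<^sup>2 \<le> s} = cball 0 (sqrt s)"
  proof (rule Set.set_eqI)
    fix z :: complex
    have "(cmod z)\<^sup>2 \<le> s \<longleftrightarrow> sqrt ((cmod z)\<^sup>2) \<le> sqrt s" by (simp only: real_sqrt_le_iff)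
    then show "z \<in> {z. (cmod z)\<^sup>2 \<le> s} \<longleftrightarrow> z \<in> cball 0 (sqrt s)" by simp
  qed
  then show ?thesis
    using assms by (simp add: emeasure_cball eval_unit_ball_vol)
qed

text \<open>Layer cake: \<open>exp (- \<bar>z\<bar>\<^sup>2)\<close> is the integral of \<open>exp (- s)\<close> over \<open>s \<ge> \<bar>z\<bar>\<^sup>2\<close>.\<close>

lemma emeasure_complex_gaussian_norm_square_gt:
  assumes t: "t \<ge> 0"
  shows "emeasure complex_gaussian {z. t < (cmod z)\<^sup>2} = ennreal (exp (- t))"
proof -
  \<comment> \<open>Once the layer-cake integrals are swapped, the inner one is the area of the
    annulus \<open>t < (cmod z)\<^sup>2 \<le> s\<close>.\<close>
  have shell: "emeasure lborel {z. t < (cmod z)\<^sup>2 \<and> (cmod z)\<^sup>2 \<le> s} = ennreal (pi * (s - t)) * indicator {t..} s"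
    for s :: real
  proof (cases "t \<le> s")
    case True
    have "{z. t < (cmod z)\<^sup>2 \<and> (cmod z)\<^sup>2 \<le> s} = {z. (cmod z)\<^sup>2 \<le> s} - {z. (cmod z)\<^sup>2 \<le> t}" by auto
    also have "emeasure lborel \<dots> = emeasure lborel {z::complex. (cmod z)\<^sup>2 \<le> s} - emeasure lborel {z::complex. (cmod z)\<^sup>2 \<le> t}"
      using True t by (intro emeasure_Diff) (auto simp: emeasure_norm_square_le)
    also have "\<dots> = ennreal (pi * (s - t))"
      using True t by (simp add: emeasure_norm_square_le ennreal_minus algebra_simps)
    finally show ?thesis using True by simp
  next
    case False
    then have empty: "{z. t < (cmod z)\<^sup>2 \<and> (cmod z)\<^sup>2 \<le> s} = {}" by auto
    show ?thesis using False by (subst empty) simp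
  qed
  have expint: "(\<integral>\<^sup>+s. ennreal (exp (- s)) * indicator {r..} s \<partial>lborel) = ennreal (exp (- r))" for r :: real
  proof -
    have "(\<integral>\<^sup>+s. ennreal (exp (- s)) * indicator {r..} s \<partial>lborel) = ennreal (0 - (- exp (- r)))"
    proof (rule nn_integral_FTC_atLeast[where F = "\<lambda>s. - exp (- s)"])
      show "((\<lambda>s::real. - exp (- s)) \<longlongrightarrow> 0) at_top" by real_asymp
    qed (auto intro!: derivative_eq_intros)
    then show ?thesis by simp
  qed
  have "emeasure complex_gaussian {z. t < (cmod z)\<^sup>2}
    = (\<integral>\<^sup>+z. ennreal (exp (- (cmod z)\<^sup>2) / pi) * indicator {z. t < (cmod z)\<^sup>2} z \<partial>lborel)"
    unfolding complex_gaussian_def by (subst emeasure_density) auto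
  also have "\<dots> = (\<integral>\<^sup>+z. \<integral>\<^sup>+s. ennreal (1 / pi) * (ennreal (exp (- s)) * indicator {(cmod z)\<^sup>2..} s) * indicator {z. t < (cmod z)\<^sup>2} z \<partial>lborel \<partial>lborel)"
    by (intro nn_integral_cong, subst nn_integral_multc, simp, subst nn_integral_cmult)
       (simp_all add: expint ennreal_mult[symmetric])
  also have "\<dots> = (\<integral>\<^sup>+z. \<integral>\<^sup>+s. ennreal (1 / pi) * ennreal (exp (- s)) * indicator {z. t < (cmod z)\<^sup>2 \<and> (cmod z)\<^sup>2 \<le> s} z \<partial>lborel \<partial>lborel)"
    by (intro nn_integral_cong) (auto split: split_indicator)
  also have "\<dots> = (\<integral>\<^sup>+s. \<integral>\<^sup>+z. ennreal (1 / pi) * ennreal (exp (- s)) * indicator {z. t < (cmod z)\<^sup>2 \<and> (cmod z)\<^sup>2 \<le> s} z \<partial>lborel \<partial>lborel)"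
  proof (rule lborel_pair.Fubini')
    have "(\<lambda>x. ennreal (1 / pi) * ennreal (exp (- fst x)) *
        (if t < (cmod (snd x))\<^sup>2 \<and> (cmod (snd x))\<^sup>2 \<le> fst x then 1 else 0))
      \<in> borel_measurable (lborel \<Otimes>\<^sub>M lborel)"
      by measurable
    then show "(\<lambda>(s, z). ennreal (1 / pi) * ennreal (exp (- s)) *
        indicator {z. t < (cmod z)\<^sup>2 \<and> (cmod z)\<^sup>2 \<le> s} z) \<in> borel_measurable (lborel \<Otimes>\<^sub>M lborel)"
      by (simp add: indicator_def case_prod_beta' of_bool_def)
  qed
  also have "\<dots> = (\<integral>\<^sup>+s. ennreal (exp (- s) * (s - t)) * indicator {t..} s \<partial>lborel)"
  proof (intro nn_integral_cong)
    fix s :: real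
    have "(\<integral>\<^sup>+z. ennreal (1 / pi) * ennreal (exp (- s)) * indicator {z. t < (cmod z)\<^sup>2 \<and> (cmod z)\<^sup>2 \<le> s} z \<partial>lborel)
      = ennreal (1 / pi) * ennreal (exp (- s)) * (ennreal (pi * (s - t)) * indicator {t..} s)"
      by (subst nn_integral_cmult_indicator) (simp_all add: shell)
    also have "\<dots> = ennreal (exp (- s) * (s - t)) * indicator {t..} s"
      by (cases "t \<le> s") (simp_all add: ennreal_mult[symmetric])
    finally show "(\<integral>\<^sup>+z. ennreal (1 / pi) * ennreal (exp (- s)) * indicator {z. t < (cmod z)\<^sup>2 \<and> (cmod z)\<^sup>2 \<le> s} z \<partial>lborel)
      = ennreal (exp (- s) * (s - t)) * indicator {t..} s" .
  qed
  also have "\<dots> = ennreal (0 - (- (exp (- t) * (t - t + 1))))"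
  proof (rule nn_integral_FTC_atLeast[where F = "\<lambda>s. - (exp (- s) * (s - t + 1))"])
    show "((\<lambda>s. - (exp (- s) * (s - t + 1))) \<longlongrightarrow> 0) at_top" by real_asymp
  qed (auto intro!: derivative_eq_intros simp: algebra_simps)
  finally show ?thesis by simp
qed

lemma prob_space_complex_gaussian: "prob_space complex_gaussian"
proof
  \<comment> \<open>The tail formula at \<open>t = 0\<close> gives the mass of the punctured plane,
    so only the origin has to be added.\<close>
  have "emeasure complex_gaussian {0} = 0"
    unfolding complex_gaussian_def
    by (subst emeasure_density) (auto simp: nn_integral_indicator_singleton)
  moreover have "emeasure complex_gaussian UNIV = emeasure complex_gaussian ({z. 0 < (cmod z)\<^sup>2} \<union> {0})"
    by (rule arg_cong[where f = "emeasure complex_gaussian"]) auto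
  moreover have "\<dots> = emeasure complex_gaussian {z. 0 < (cmod z)\<^sup>2} + emeasure complex_gaussian {0}"
    by (intro plus_emeasure[symmetric]) auto
  ultimately show "emeasure complex_gaussian (space complex_gaussian) = 1"
    using emeasure_complex_gaussian_norm_square_gt[of 0] by simp
qed

interpretation complex_gaussian: prob_space complex_gaussian
  by (rule prob_space_complex_gaussian)

lemma distributed_complex_gaussian_norm_square:
  "distributed complex_gaussian lborel (\<lambda>z. (cmod z)\<^sup>2) (exponential_density 1)"
proof (subst complex_gaussian.exponential_distributed_iff, simp, intro conjI allI impI)
  fix a :: real assume a: "0 \<le> a"
  have "complex_gaussian.prob {z \<in> space complex_gaussian. (cmod z)\<^sup>2 \<le> a} = 1 - complex_gaussian.prob {z. a < (cmod z)\<^sup>2}"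
    by (subst complex_gaussian.prob_compl[symmetric]) (auto intro!: arg_cong[where f = complex_gaussian.prob])
  also have "\<dots> = 1 - exp (- a * 1)"
    using emeasure_complex_gaussian_norm_square_gt[OF a] by (simp add: measure_def)
  finally show "complex_gaussian.prob {z \<in> space complex_gaussian. (cmod z)\<^sup>2 \<le> a} = 1 - exp (- a * 1)" .
qed measurable

subsection \<open>Expected logarithm of an Erlang variable\<close>

text \<open>From \<open>ln y < y\<close> at \<open>y = x\<close> and at
  \<open>y = x powr (-1/2)\<close>. The exponent -1/2 keeps the bound integrable at 0.\<close>

lemma abs_ln_le: "x > 0 \<Longrightarrow> \<bar>ln x\<bar> \<le> x + 2 * x powr (-1/2)" for x :: real
proof -
  assume x: "x > 0"
  have "ln x \<le> x" using ln_less_self[OF x] by simp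
  moreover have "- ln x \<le> 2 * x powr (-1/2)"
  proof -
    have "ln (x powr (-1/2)) \<le> x powr (-1/2)" using x by (intro less_imp_le ln_less_self) simp
    then show ?thesis using x by (simp add: ln_powr)
  qed
  moreover have "0 \<le> x powr (-1/2)" by simp
  ultimately show ?thesis using x unfolding abs_le_iff by linarith
qed

lemma integrable_Gamma_integrand:
  assumes "z > 0"
  shows "integrable lborel (\<lambda>x::real. indicator {0..} x * (x powr (z - 1) * exp (- x)))"
proof -
  \<comment> \<open>\<open>Gamma_integral_real\<close> speaks of the gauge integral; nonnegativity
    of the integrand turns it into a Lebesgue integral.\<close>
  have "(\<lambda>x. x powr (z - 1) / exp x) absolutely_integrable_on {0..}"
    using Gamma_integral_real[OF assms] by (intro nonnegative_absolutely_integrable_1) (auto simp: has_integral_integrable)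
  then have "integrable lebesgue (\<lambda>x::real. indicator {0..} x * (x powr (z - 1) * exp (- x)))"
    by (simp add: set_integrable_def exp_minus field_simps)
  then show ?thesis by (subst (asm) integrable_completion) auto
qed

lemma integrable_erlang_ln: "integrable lborel (\<lambda>x. erlang_density n 1 x * ln x)"
proof (rule Bochner_Integration.integrable_bound)
  \<comment> \<open>The bound of \<open>abs_ln_le\<close> times \<open>x ^ n * exp (- x)\<close>
    gives Gamma integrands with parameters \<open>n + 2\<close> and \<open>n + 1/2\<close>; the
    second is positive even for \<open>n = 0\<close>.\<close>
  have "integrable lborel (\<lambda>x::real. indicator {0..} x * (x powr (real n + 2 - 1) * exp (- x))
      + 2 * (indicator {0..} x * (x powr (real n + 1/2 - 1) * exp (- x))))"
    by (intro Bochner_Integration.integrable_add integrable_mult_right integrable_Gamma_integrand) simp_all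
  then show "integrable lborel (\<lambda>x::real. indicator {0..} x * (x powr (real n + 2 - 1) * exp (- x))
      + 2 * (indicator {0..} x * (x powr (real n + 1/2 - 1) * exp (- x))))" .
  show "AE x in lborel. norm (erlang_density n 1 x * ln x)
    \<le> norm (indicator {0..} x * (x powr (real n + 2 - 1) * exp (- x))
      + 2 * (indicator {0..} x * (x powr (real n + 1/2 - 1) * exp (- x))))"
  proof (rule AE_I2)
    fix x :: real
    consider "x < 0" | "x = 0" | "x > 0" by linarith
    then show "norm (erlang_density n 1 x * ln x)
      \<le> norm (indicator {0..} x * (x powr (real n + 2 - 1) * exp (- x))
      + 2 * (indicator {0..} x * (x powr (real n + 1/2 - 1) * exp (- x))))"
    proof cases
      case 3
      have "erlang_density n 1 x \<le> x powr n * exp (- x)"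
        using 3 by (simp add: erlang_density_def powr_realpow divide_le_eq_1 field_simps mult_le_cancel_left1 fact_ge_1)
      then have "norm (erlang_density n 1 x * ln x) \<le> (x powr n * exp (- x)) * (x + 2 * x powr (-1/2))"
        using abs_ln_le[OF 3] 3 by (simp add: abs_mult) (intro mult_mono; simp)
      also have "\<dots> = x powr (real n + 2 - 1) * exp (- x) + 2 * (x powr (real n + 1/2 - 1) * exp (- x))"
      proof -
        have "x powr n * x = x powr (real n + 2 - 1)"
          "x powr n * x powr (-1/2) = x powr (real n + 1/2 - 1)"
          using 3 by (simp_all add: powr_add[symmetric] powr_mult_base mult.commute[of "x powr n" x])
        then show ?thesis using 3 by (simp add: algebra_simps)
      qed
      finally show ?thesis using 3 by simp
    qed (simp_all add: erlang_density_def)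
  qed
qed measurable

text \<open>The digamma value \<psi>(n + 1): \<open>erlang_density n 1\<close> is the density of a
  sum of n + 1 standard exponentials.\<close>

definition erlang_ln :: "nat \<Rightarrow> real" where
  "erlang_ln n = (LBINT x. erlang_density n 1 x * ln x)"

text \<open>Integration by parts. On the positive reals \<open>F\<close> is \<open>ln x\<close>
  times the Erlang density of index \<open>Suc n\<close>; it vanishes at 0 and at infinity, and the
  integral of its derivative \<open>f\<close> is the difference of the two sides.\<close>

lemma erlang_ln_Suc: "erlang_ln (Suc n) = erlang_ln n + 1 / real (Suc n)"
proof -
  define F where "F x = ln x * (x ^ Suc n * exp (- x) / fact (Suc n))" for x :: real
  define f where "f x = erlang_density n 1 x * ln x + erlang_density n 1 x / real (Suc n)
     - erlang_density (Suc n) 1 x * ln x" for x :: real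
  have int0: "integrable lborel (erlang_density n 1)" "(LBINT x. erlang_density n 1 x) = 1"
  proof -
    interpret prob_space "density lborel (erlang_density n 1)" by (rule prob_space_erlang_density) simp
    have 1: "integrable (density lborel (erlang_density n 1)) (\<lambda>_. 1::real)" by simp
    have 2: "(\<integral>x. (1::real) \<partial>(density lborel (erlang_density n 1))) = 1"
      using prob_space by simp
    show "integrable lborel (erlang_density n 1)"
      using 1 by (subst (asm) integrable_real_density) auto
    show "(LBINT x. erlang_density n 1 x) = 1"
      using 2 by (subst (asm) integral_real_density) auto
  qed
  have intf: "integrable lborel f"
    unfolding f_def using int0 by (intro Bochner_Integration.integrable_add Bochner_Integration.integrable_diff integrable_erlang_ln) auto
  have "(LBINT x=0..\<infinity>. f x) = 0 - 0"
  proof (rule interval_integral_FTC_integrable[where F = F])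
    fix x :: real assume "(0::ereal) < ereal x"
    then have x: "x > 0" by simp
    have d: "((\<lambda>x. ln x * (x ^ Suc n * exp (- x) / fact (Suc n))) has_real_derivative
       (1/x * (x ^ Suc n * exp (- x) / fact (Suc n)) +
        ln x * (((real (Suc n) * x ^ n) * exp (- x) + x ^ Suc n * (- exp (- x))) / fact (Suc n)))) (at x)"
    proof -
      have pow: "((\<lambda>x. x ^ Suc n) has_real_derivative real (Suc n) * x ^ n) (at x)"
        using DERIV_pow[of "Suc n" x] by simp
      have ex: "((\<lambda>x. exp (- x)) has_real_derivative - exp (- x)) (at x)"
        by (auto intro!: derivative_eq_intros)
      have "((\<lambda>x. x ^ Suc n * exp (- x) / fact (Suc n)) has_real_derivative
          ((real (Suc n) * x ^ n) * exp (- x) + x ^ Suc n * (- exp (- x))) / fact (Suc n)) (at x)"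
        using DERIV_cdivide[OF DERIV_mult'[OF pow ex]] by (simp only: add.commute mult.commute)
      from DERIV_mult'[OF DERIV_ln_divide[OF x] this] show ?thesis by (simp only: add.commute)
    qed
    have "(1/x * (x ^ Suc n * exp (- x) / fact (Suc n)) +
        ln x * (((real (Suc n) * x ^ n) * exp (- x) + x ^ Suc n * (- exp (- x))) / fact (Suc n))) = f x"
      using x unfolding f_def by (simp add: erlang_density_def fact_Suc divide_simps del: of_nat_Suc) (simp add: algebra_simps)
    with d show "(F has_vector_derivative f x) (at x)"
      unfolding F_def by (simp add: has_real_derivative_iff_has_vector_derivative)
    have "continuous_on {0<..} f"
    proof -
      have "continuous_on {0<..} (\<lambda>x. (x ^ n * exp (- x) / fact n) * ln x + (x ^ n * exp (- x) / fact n) / real (Suc n)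
        - (x ^ Suc n * exp (- x) / fact (Suc n)) * ln x)"
        by (intro continuous_intros) auto
      then show ?thesis
        by (rule continuous_on_eq) (simp add: f_def erlang_density_def)
    qed
    then show "isCont f x" using x by (simp add: continuous_on_eq_continuous_at)
  next
    show "set_integrable lborel (einterval 0 \<infinity>) f"
      unfolding set_integrable_def using intf by (intro integrable_mult_indicator) auto
  next
    have "((\<lambda>x::real. ln x * (x ^ Suc n * exp (- x) / fact (Suc n))) \<longlongrightarrow> 0) (at_right 0)"
      by real_asymp
    then show "((F \<circ> real_of_ereal) \<longlongrightarrow> 0) (at_right 0)"
      unfolding F_def[abs_def] zero_ereal_def ereal_tendsto_simps1 .
  next
    have "((\<lambda>x::real. ln x * (x ^ Suc n * exp (- x) / fact (Suc n))) \<longlongrightarrow> 0) at_top"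
      by real_asymp
    then show "((F \<circ> real_of_ereal) \<longlongrightarrow> 0) (at_left \<infinity>)"
      unfolding F_def[abs_def] ereal_tendsto_simps1 .
  qed simp
  then have "0 = (LBINT x=0..\<infinity>. f x)" by simp
  also have "\<dots> = (LBINT x:{0<..}. f x)"
    by (simp add: interval_integral_to_infinity_eq zero_ereal_def)
  also have "\<dots> = (LBINT x. f x)"
    unfolding set_lebesgue_integral_def
  proof (rule integral_cong_AE)
    show "AE x in lborel. indicator {0<..} x *\<^sub>R f x = f x"
      using AE_lborel_singleton[of 0]
      by eventually_elim (auto simp: f_def erlang_density_def indicator_def)
  qed (use intf in auto)
  also have "\<dots> = erlang_ln n + 1 / real (Suc n) - erlang_ln (Suc n)"
    unfolding f_def erlang_ln_def using int0
    by (subst Bochner_Integration.integral_diff Bochner_Integration.integral_add;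
        simp add: integrable_erlang_ln del: of_nat_Suc)+
  finally show ?thesis by simp
qed

subsection \<open>Isometries preserving the Gaussian law\<close>

definition gauss_vec :: "nat \<Rightarrow> (nat \<Rightarrow> complex) measure" where
  "gauss_vec M = PiM {..<M} (\<lambda>_. complex_gaussian)"

interpretation gauss_prod: product_prob_space "\<lambda>_. complex_gaussian" I for I
  by unfold_locales

lemma prob_space_gauss_vec: "prob_space (gauss_vec M)"
  unfolding gauss_vec_def by (rule prob_space_PiM) (rule prob_space_complex_gaussian)

lemma measurable_gauss_vec_component[measurable]:
  "a < M \<Longrightarrow> (\<lambda>h. h a) \<in> borel_measurable (gauss_vec M)"
proof -
  assume "a < M"
  then have "(\<lambda>h. h a) \<in> measurable (gauss_vec M) complex_gaussian"
    unfolding gauss_vec_def by (intro measurable_component_singleton) simp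
  then show ?thesis by (simp cong: measurable_cong_sets)
qed

definition dotp :: "nat \<Rightarrow> (nat \<Rightarrow> complex) \<Rightarrow> (nat \<Rightarrow> complex) \<Rightarrow> complex" where
  "dotp M x y = (\<Sum>a<M. x a * cnj (y a))"

text \<open>Only preservation of inner products is recorded: linearity is never needed, since Gram
  matrices are the only objects transported along such maps.\<close>

definition gauss_isometry :: "nat \<Rightarrow> ((nat \<Rightarrow> complex) \<Rightarrow> (nat \<Rightarrow> complex)) \<Rightarrow> bool" where
  "gauss_isometry M T \<longleftrightarrow> (\<forall>x y. dotp M (T x) (T y) = dotp M x y) \<and>
    T \<in> measurable (gauss_vec M) (gauss_vec M) \<and>
    (\<forall>\<psi>\<in>borel_measurable (gauss_vec M).
      (\<integral>\<^sup>+h. \<psi> (T h) \<partial>gauss_vec M) = (\<integral>\<^sup>+h. (\<psi> h :: ennreal) \<partial>gauss_vec M))"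

lemma gauss_isometry_nn_integral:
  fixes \<psi> :: "_ \<Rightarrow> ennreal"
  assumes "gauss_isometry M T" "\<psi> \<in> borel_measurable (gauss_vec M)"
  shows "(\<integral>\<^sup>+h. \<psi> (T h) \<partial>gauss_vec M) = (\<integral>\<^sup>+h. \<psi> h \<partial>gauss_vec M)"
  using assms unfolding gauss_isometry_def by blast

lemma gauss_isometry_id: "gauss_isometry M (\<lambda>x. x)"
  by (simp add: gauss_isometry_def)

lemma gauss_isometry_comp:
  assumes S: "gauss_isometry M S" and T: "gauss_isometry M T"
  shows "gauss_isometry M (\<lambda>x. S (T x))"
proof -
  have [measurable]: "S \<in> measurable (gauss_vec M) (gauss_vec M)" "T \<in> measurable (gauss_vec M) (gauss_vec M)"
    using S T by (auto simp: gauss_isometry_def)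
  have "(\<integral>\<^sup>+h. \<psi> (S (T h)) \<partial>gauss_vec M) = (\<integral>\<^sup>+h. \<psi> h \<partial>gauss_vec M)"
    if [measurable]: "\<psi> \<in> borel_measurable (gauss_vec M)" for \<psi> :: "_ \<Rightarrow> ennreal"
  proof -
    have "(\<lambda>h. \<psi> (S h)) \<in> borel_measurable (gauss_vec M)" by measurable
    then have "(\<integral>\<^sup>+h. \<psi> (S (T h)) \<partial>gauss_vec M) = (\<integral>\<^sup>+h. \<psi> (S h) \<partial>gauss_vec M)"
      by (rule gauss_isometry_nn_integral[OF T])
    also have "\<dots> = (\<integral>\<^sup>+h. \<psi> h \<partial>gauss_vec M)"
      using that by (rule gauss_isometry_nn_integral[OF S])
    finally show ?thesis .
  qed
  moreover have "(\<lambda>x. S (T x)) \<in> measurable (gauss_vec M) (gauss_vec M)" by measurable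
  ultimately show ?thesis using S T by (simp add: gauss_isometry_def)
qed

text \<open>A rotation in the plane of coordinates \<open>i\<close> and \<open>j\<close>. The
  conjugates are placed so that \<open>c\<close> and \<open>s\<close> proportional to
  \<open>x i\<close> and \<open>x j\<close> annihilate coordinate \<open>j\<close> of
  \<open>x\<close>.\<close>

definition givens :: "complex \<Rightarrow> complex \<Rightarrow> nat \<Rightarrow> nat \<Rightarrow> (nat \<Rightarrow> complex) \<Rightarrow> (nat \<Rightarrow> complex)" where
  "givens c s i j x = x(i := cnj c * x i + cnj s * x j, j := c * x j - s * x i)"

lemma dotp_split:
  assumes "i < M" "j < M" "i \<noteq> j"
  shows "dotp M x y = x i * cnj (y i) + x j * cnj (y j) + (\<Sum>a\<in>{..<M} - {i, j}. x a * cnj (y a))"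
proof -
  have "{..<M} = insert i (insert j ({..<M} - {i, j}))" using assms by auto
  then have "dotp M x y = (\<Sum>a\<in>insert i (insert j ({..<M} - {i, j})). x a * cnj (y a))"
    unfolding dotp_def by simp
  also have "\<dots> = x i * cnj (y i) + x j * cnj (y j) + (\<Sum>a\<in>{..<M} - {i, j}. x a * cnj (y a))"
    using assms by (subst sum.insert; simp)+
  finally show ?thesis .
qed

lemma gauss_isometry_givens:
  assumes ij: "i < M" "j < M" "i \<noteq> j" and cs: "c * cnj c + s * cnj s = 1" and s: "s \<noteq> 0"
  shows "gauss_isometry M (givens c s i j)"
proof -
  define I where "I = {..<M} - {i, j}"
  have M_eq: "{..<M} = insert j (insert i I)" and I: "finite I" "i \<notin> I" "j \<notin> insert i I"
    using ij by (auto simp: I_def)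
  have meas: "givens c s i j \<in> measurable (gauss_vec M) (gauss_vec M)"
  proof -
    have "(\<lambda>x. x(i := cnj c * x i + cnj s * x j)) \<in> measurable (gauss_vec M) (gauss_vec M)"
      unfolding gauss_vec_def
    proof (rule measurable_fun_upd[where J = "{..<M}"])
      have "(\<lambda>x. cnj c * x i + cnj s * x j) \<in> borel_measurable (gauss_vec M)"
        using ij by measurable
      then show "(\<lambda>x. cnj c * x i + cnj s * x j) \<in> measurable (Pi\<^sub>M {..<M} (\<lambda>_. complex_gaussian)) complex_gaussian"
        by (simp add: gauss_vec_def cong: measurable_cong_sets)
    qed (use ij in auto)
    then show ?thesis
      unfolding gauss_vec_def givens_def
    proof (rule measurable_fun_upd[where J = "{..<M}", rotated])
      have "(\<lambda>x. c * x j - s * x i) \<in> borel_measurable (gauss_vec M)"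
        using ij by measurable
      then show "(\<lambda>x. c * x j - s * x i) \<in> measurable (Pi\<^sub>M {..<M} (\<lambda>_. complex_gaussian)) complex_gaussian"
        by (simp add: gauss_vec_def cong: measurable_cong_sets)
    qed (use ij in auto)
  qed
  have "(\<integral>\<^sup>+h. \<psi> (givens c s i j h) \<partial>gauss_vec M) = (\<integral>\<^sup>+h. \<psi> h \<partial>gauss_vec M)"
    if \<psi>[measurable]: "\<psi> \<in> borel_measurable (gauss_vec M)" for \<psi> :: "_ \<Rightarrow> ennreal"
  proof -
    \<comment> \<open>Fubini makes coordinates \<open>i\<close> and \<open>j\<close> the two
      innermost integrals, with all others frozen in \<open>x\<close>; there the planar invariance
      applies.\<close>
    have fold: "(\<integral>\<^sup>+h. \<phi> h \<partial>gauss_vec M) =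
        (\<integral>\<^sup>+x. \<integral>\<^sup>+u. \<integral>\<^sup>+v. \<phi> (x(i := u, j := v)) \<partial>complex_gaussian \<partial>complex_gaussian \<partial>(PiM I (\<lambda>_. complex_gaussian)))"
      if \<phi>: "\<phi> \<in> borel_measurable (gauss_vec M)" for \<phi> :: "_ \<Rightarrow> ennreal"
    proof -
      have [measurable]: "\<phi> \<in> borel_measurable (PiM (insert j (insert i I)) (\<lambda>_. complex_gaussian))"
        using \<phi> by (simp add: gauss_vec_def M_eq)
      have "(\<integral>\<^sup>+h. \<phi> h \<partial>gauss_vec M) = (\<integral>\<^sup>+h. \<phi> h \<partial>(PiM (insert j (insert i I)) (\<lambda>_. complex_gaussian)))"
        by (simp add: gauss_vec_def M_eq)
      also have "\<dots> = (\<integral>\<^sup>+x. \<integral>\<^sup>+v. \<phi> (x(j := v)) \<partial>complex_gaussian \<partial>(PiM (insert i I) (\<lambda>_. complex_gaussian)))"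
        using I by (intro gauss_prod.product_nn_integral_insert) auto
      also have "\<dots> = (\<integral>\<^sup>+x. \<integral>\<^sup>+u. \<integral>\<^sup>+v. \<phi> (x(i := u, j := v)) \<partial>complex_gaussian \<partial>complex_gaussian \<partial>(PiM I (\<lambda>_. complex_gaussian)))"
        using I by (intro gauss_prod.product_nn_integral_insert) auto
      finally show ?thesis .
    qed
    have "(\<integral>\<^sup>+h. \<psi> (givens c s i j h) \<partial>gauss_vec M) = (\<integral>\<^sup>+x. \<integral>\<^sup>+u. \<integral>\<^sup>+v. \<psi> (givens c s i j (x(i := u, j := v)))
        \<partial>complex_gaussian \<partial>complex_gaussian \<partial>(PiM I (\<lambda>_. complex_gaussian)))"
      using meas by (intro fold) measurable
    also have "\<dots> = (\<integral>\<^sup>+x. \<integral>\<^sup>+u. \<integral>\<^sup>+v. (\<lambda>u v. \<psi> (x(i := u, j := v))) (cnj c * u + cnj s * v) (c * v - s * u)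
        \<partial>complex_gaussian \<partial>complex_gaussian \<partial>(PiM I (\<lambda>_. complex_gaussian)))"
      using ij by (simp add: givens_def fun_upd_twist)
    also have "\<dots> = (\<integral>\<^sup>+x. \<integral>\<^sup>+u. \<integral>\<^sup>+v. \<psi> (x(i := u, j := v)) \<partial>complex_gaussian \<partial>complex_gaussian \<partial>(PiM I (\<lambda>_. complex_gaussian)))"
    proof (rule nn_integral_cong, rule nn_integral_gaussian_rotation[OF _ cs s])
      fix x assume x: "x \<in> space (PiM I (\<lambda>_. complex_gaussian))"
      have "(\<lambda>p. x(i := fst p)) \<in> measurable (borel \<Otimes>\<^sub>M borel) (PiM (insert i I) (\<lambda>_. complex_gaussian))"
        using x I by (intro measurable_fun_upd[where J = I]) (auto cong: measurable_cong_sets)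
      then have "(\<lambda>p. (x(i := fst p))(j := snd p)) \<in> measurable (borel \<Otimes>\<^sub>M borel) (gauss_vec M)"
        unfolding gauss_vec_def M_eq
        by (rule measurable_fun_upd[where J = "insert i I", rotated]) (auto cong: measurable_cong_sets)
      then show "(\<lambda>(u, v). \<psi> (x(i := u, j := v))) \<in> borel_measurable (borel \<Otimes>\<^sub>M borel)"
        unfolding case_prod_beta' by (rule measurable_compose) (rule \<psi>)
    qed
    also have "\<dots> = (\<integral>\<^sup>+h. \<psi> h \<partial>gauss_vec M)" by (rule fold[symmetric]) (rule \<psi>)
    finally show ?thesis .
  qed
  moreover have "dotp M (givens c s i j x) (givens c s i j y) = dotp M x y" for x y
  proof -
    have "dotp M (givens c s i j x) (givens c s i j y) =
      (cnj c * x i + cnj s * x j) * cnj (cnj c * y i + cnj s * y j)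
      + (c * x j - s * x i) * cnj (c * y j - s * y i) + (\<Sum>a\<in>{..<M} - {i, j}. x a * cnj (y a))"
      using ij by (subst dotp_split[OF ij]) (auto simp: givens_def)
    also have "(cnj c * x i + cnj s * x j) * cnj (cnj c * y i + cnj s * y j)
      + (c * x j - s * x i) * cnj (c * y j - s * y i) = (c * cnj c + s * cnj s) * (x i * cnj (y i) + x j * cnj (y j))"
      by (simp add: algebra_simps)
    finally show ?thesis using cs by (subst dotp_split[OF ij]) simp
  qed
  ultimately show ?thesis using meas by (simp add: gauss_isometry_def)
qed

text \<open>The last two clauses guarantee that zeros produced earlier survive. If
  \<open>x j\<close> is already zero the identity serves, because
  \<open>gauss_isometry_givens\<close> asks for \<open>s \<noteq> 0\<close>.\<close>

lemma exists_givens_zero: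
  assumes ij: "i < M" "j < M" "i \<noteq> j"
  shows "\<exists>T. gauss_isometry M T \<and> T x j = 0 \<and> (\<forall>y a. a \<noteq> i \<longrightarrow> a \<noteq> j \<longrightarrow> T y a = y a) \<and>
    (\<forall>y. y i = 0 \<longrightarrow> y j = 0 \<longrightarrow> T y = y)"
proof (cases "x j = 0")
  case True
  then show ?thesis using gauss_isometry_id[of M] by (intro exI[of _ "\<lambda>x. x"]) simp
next
  case False
  define r where "r = sqrt ((cmod (x i))\<^sup>2 + (cmod (x j))\<^sup>2)"
  have r: "r \<noteq> 0" using False by (simp add: r_def add_nonneg_eq_0_iff)
  define c s where "c = x i / of_real r" and "s = x j / of_real r"
  have r2: "of_real r * of_real r = x i * cnj (x i) + x j * cnj (x j)"
  proof -
    have "complex_of_real r * of_real r = of_real (r\<^sup>2)" by (simp add: power2_eq_square)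
    also have "r\<^sup>2 = (cmod (x i))\<^sup>2 + (cmod (x j))\<^sup>2" by (simp add: r_def)
    finally show ?thesis by (simp only: of_real_add complex_norm_square)
  qed
  have "c * cnj c + s * cnj s = (x i * cnj (x i) + x j * cnj (x j)) / (of_real r * of_real r)"
    by (simp add: c_def s_def add_divide_distrib)
  also have "\<dots> = 1" using r by (simp add: r2[symmetric])
  finally have "gauss_isometry M (givens c s i j)"
    using ij False r by (intro gauss_isometry_givens) (auto simp: s_def)
  moreover have "givens c s i j x j = 0" by (simp add: givens_def c_def s_def)
  moreover have "givens c s i j y = y" if "y i = 0" "y j = 0" for y
    using that by (auto simp: givens_def fun_eq_iff)
  ultimately show ?thesis by (intro exI[of _ "givens c s i j"]) (auto simp: givens_def)
qed

text \<open>One elimination step of a QR factorisation: each coordinate beyond \<open>m\<close> is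
  rotated in turn into coordinate \<open>m\<close>. All planes involved avoid the coordinates below
  \<open>m\<close>, whence the last clause, which protects the rows treated before.\<close>

lemma exists_isometry_column:
  assumes m: "m < M" and n: "n \<le> M"
  shows "\<exists>T. gauss_isometry M T \<and> (\<forall>a. m < a \<longrightarrow> a < n \<longrightarrow> T x a = 0) \<and>
    (\<forall>y. (\<forall>a. m \<le> a \<longrightarrow> a < M \<longrightarrow> y a = 0) \<longrightarrow> T y = y)"
  using n
proof (induction n)
  case 0
  then show ?case using gauss_isometry_id[of M] by (intro exI[of _ "\<lambda>x. x"]) simp
next
  case (Suc n)
  then obtain T where T: "gauss_isometry M T" "\<And>a. m < a \<Longrightarrow> a < n \<Longrightarrow> T x a = 0"
    "\<And>y. (\<forall>a. m \<le> a \<longrightarrow> a < M \<longrightarrow> y a = 0) \<Longrightarrow> T y = y"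
    by auto
  show ?case
  proof (cases "m < n")
    case False
    then show ?thesis using T by (intro exI[of _ T]) auto
  next
    case True
    obtain G where G: "gauss_isometry M G" "G (T x) n = 0" "\<And>y a. a \<noteq> m \<Longrightarrow> a \<noteq> n \<Longrightarrow> G y a = y a"
      "\<And>y. y m = 0 \<Longrightarrow> y n = 0 \<Longrightarrow> G y = y"
      using exists_givens_zero[of m M n "T x"] True m Suc.prems by auto
    have "\<forall>a. m < a \<longrightarrow> a < Suc n \<longrightarrow> G (T x) a = 0"
    proof (intro allI impI)
      fix a assume "m < a" "a < Suc n"
      then show "G (T x) a = 0" using T(2)[of a] G(2) G(3)[of a "T x"] by (cases "a = n") auto
    qed
    moreover have "G (T y) = y" if "\<forall>a. m \<le> a \<longrightarrow> a < M \<longrightarrow> y a = 0" for y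
      using T(3)[OF that] G(4)[of y] that True m Suc.prems by auto
    ultimately show ?thesis
      using gauss_isometry_comp[OF G(1) T(1)] by (intro exI[of _ "\<lambda>x. G (T x)"]) auto
  qed
qed

lemma exists_isometry_triangular:
  assumes "m \<le> M"
  shows "\<exists>T. gauss_isometry M T \<and> (\<forall>j<m. \<forall>a. j < a \<longrightarrow> a < M \<longrightarrow> T (x j) a = 0)"
  using assms
proof (induction m)
  case 0
  then show ?case using gauss_isometry_id by auto
next
  case (Suc m)
  then obtain T where T: "gauss_isometry M T" "\<And>j a. j < m \<Longrightarrow> j < a \<Longrightarrow> a < M \<Longrightarrow> T (x j) a = 0"
    by auto
  obtain S where S: "gauss_isometry M S" "\<And>a. m < a \<Longrightarrow> a < M \<Longrightarrow> S (T (x m)) a = 0"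
    "\<And>y. (\<forall>a. m \<le> a \<longrightarrow> a < M \<longrightarrow> y a = 0) \<Longrightarrow> S y = y"
    using exists_isometry_column[of m M M "T (x m)"] Suc.prems by auto
  have "S (T (x j)) a = 0" if "j < Suc m" "j < a" "a < M" for j a
  proof (cases "j = m")
    case False
    then have j: "j < m" using that by simp
    \<comment> \<open>Row \<open>j < m\<close> vanishes at every coordinate from \<open>m\<close>
      on, as these exceed \<open>j\<close>; such vectors are fixed by \<open>S\<close>.\<close>
    then have "S (T (x j)) = T (x j)" by (intro S(3)) (auto intro: T(2))
    then show ?thesis using T(2)[OF j] that by simp
  qed (use S(2) that in simp)
  then show ?case using gauss_isometry_comp[OF S(1) T(1)] by (intro exI[of _ "\<lambda>x. S (T x)"]) auto
qed

subsection \<open>Gram determinants\<close>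

definition gram :: "nat \<Rightarrow> nat \<Rightarrow> (nat \<Rightarrow> nat \<Rightarrow> complex) \<Rightarrow> complex mat" where
  "gram M m x = mat m m (\<lambda>(i, j). dotp M (x i) (x j))"

lemma gram_carrier[simp]: "gram M m x \<in> carrier_mat m m"
  by (simp add: gram_def)

lemma gram_cong:
  assumes "\<And>i a. i < m \<Longrightarrow> a < M \<Longrightarrow> x i a = y i a"
  shows "gram M m x = gram M m y"
  using assms by (auto simp: gram_def dotp_def intro!: eq_matI sum.cong)

lemma gram_isometry:
  assumes "gauss_isometry M T"
  shows "gram M m (\<lambda>i. T (x i)) = gram M m x"
  using assms by (auto simp: gram_def gauss_isometry_def intro!: eq_matI)

text \<open>The rows live in the first \<open>m\<close> coordinates, so the Gram matrix is a square
  lower triangular matrix \<open>Y\<close> times its conjugate transpose \<open>Z\<close>.\<close>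

lemma det_gram_triangular:
  assumes m: "m \<le> M" and x: "\<And>j a. j < m \<Longrightarrow> j < a \<Longrightarrow> a < M \<Longrightarrow> x j a = 0"
  shows "det (gram M m x) = of_real (\<Prod>j<m. (cmod (x j j))\<^sup>2)"
proof -
  define Y where "Y = mat m m (\<lambda>(i, j). x i j)"
  define Z where "Z = mat m m (\<lambda>(i, j). cnj (x j i))"
  have Y: "Y \<in> carrier_mat m m" and Z: "Z \<in> carrier_mat m m" by (auto simp: Y_def Z_def)
  have "gram M m x = Y * Z"
  proof (rule eq_matI)
    fix i j assume "i < dim_row (Y * Z)" "j < dim_col (Y * Z)"
    then have ij: "i < m" "j < m" by (auto simp: Y_def Z_def)
    have "dotp M (x i) (x j) = (\<Sum>a<m. x i a * cnj (x j a))"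
      unfolding dotp_def using m x[of i] ij by (intro sum.mono_neutral_right) auto
    then show "gram M m x $$ (i, j) = (Y * Z) $$ (i, j)"
      using ij by (simp add: gram_def Y_def Z_def scalar_prod_def atLeast0LessThan)
  qed (auto simp: gram_def Y_def Z_def)
  then have "det (gram M m x) = det Y * det Z" using det_mult[OF Y Z] by simp
  also have "det Y = prod_list (diag_mat Y)"
    using x m by (intro det_lower_triangular[OF _ Y]) (auto simp: Y_def)
  also have "\<dots> = (\<Prod>j<m. x j j)"
    by (simp add: diag_mat_def Y_def prod.list_conv_set_nth atLeast0LessThan)
  also have "det Z = prod_list (diag_mat Z)"
    using x m by (intro det_upper_triangular[OF _ Z]) (auto simp: Z_def upper_triangular_def)
  also have "\<dots> = (\<Prod>j<m. cnj (x j j))"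
    by (simp add: diag_mat_def Z_def prod.list_conv_set_nth atLeast0LessThan)
  finally show ?thesis
    by (simp only: of_real_prod complex_norm_square prod.distrib)
qed

definition gdet :: "nat \<Rightarrow> nat \<Rightarrow> (nat \<Rightarrow> nat \<Rightarrow> complex) \<Rightarrow> real" where
  "gdet M m x = Re (det (gram M m x))"

lemma gdet_triangular:
  assumes "m \<le> M" "\<And>j a. j < m \<Longrightarrow> j < a \<Longrightarrow> a < M \<Longrightarrow> x j a = 0"
  shows "gdet M m x = (\<Prod>j<m. (cmod (x j j))\<^sup>2)"
  unfolding gdet_def using det_gram_triangular[OF assms] by (simp only: Re_complex_of_real)

text \<open>A triangularising isometry leaves the Gram matrix unchanged and exhibits its determinant
  as a product of squared moduli.\<close>

lemma det_gram_real: "m \<le> M \<Longrightarrow> det (gram M m x) = of_real (gdet M m x)"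
  and gdet_nonneg: "m \<le> M \<Longrightarrow> gdet M m x \<ge> 0"
proof -
  assume m: "m \<le> M"
  obtain T where T: "gauss_isometry M T" "\<And>j a. j < m \<Longrightarrow> j < a \<Longrightarrow> a < M \<Longrightarrow> T (x j) a = 0"
    using exists_isometry_triangular[OF m, of x] by auto
  have d: "det (gram M m x) = of_real (\<Prod>j<m. (cmod (T (x j) j))\<^sup>2)"
    using det_gram_triangular[OF m, of "\<lambda>j. T (x j)"] T(2) by (simp only: gram_isometry[OF T(1)])
  then have g: "gdet M m x = (\<Prod>j<m. (cmod (T (x j) j))\<^sup>2)" by (simp only: gdet_def Re_complex_of_real)
  show "det (gram M m x) = of_real (gdet M m x)" using d g by simp
  show "gdet M m x \<ge> 0" unfolding g by (intro prod_nonneg) auto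
qed

text \<open>If \<open>m\<close> triangular rows with nonzero diagonal are given, this is the squared
  distance of \<open>h\<close> from their span.\<close>

definition tail_norm :: "nat \<Rightarrow> nat \<Rightarrow> (nat \<Rightarrow> complex) \<Rightarrow> real" where
  "tail_norm m M h = (\<Sum>a\<in>{m..<M}. (cmod (h a))\<^sup>2)"

lemma tail_norm_measurable[measurable]: "tail_norm m M \<in> borel_measurable (gauss_vec M)"
proof -
  have "(\<lambda>h. (cmod (h a))\<^sup>2) \<in> borel_measurable (gauss_vec M)" if "a \<in> {m..<M}" for a
    using that measurable_gauss_vec_component[of a M] by auto
  then show ?thesis unfolding tail_norm_def[abs_def] by (intro borel_measurable_sum) auto
qed

lemma gdet_Suc_triangular:
  assumes m: "m < M" and x: "\<And>j a. j < m \<Longrightarrow> j < a \<Longrightarrow> a < M \<Longrightarrow> x j a = 0"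
  shows "gdet M (Suc m) x = gdet M m x * tail_norm m M (x m)"
proof -
  \<comment> \<open>Collapse the coordinates of \<open>x m\<close> beyond \<open>m\<close> to the single entry \<open>r\<close>; the Gram matrix does not
    change and the system becomes triangular.\<close>
  define r where "r = sqrt (tail_norm m M (x m))"
  have r2: "r\<^sup>2 = tail_norm m M (x m)" by (simp add: r_def tail_norm_def sum_nonneg)
  define h where "h a = (if a < m then x m a else if a = m then of_real r else 0)" for a
  let ?x = "x(m := h)"
  have split: "dotp M u v = (\<Sum>a<m. u a * cnj (v a)) + (\<Sum>a\<in>{m..<M}. u a * cnj (v a))" for u v
    unfolding dotp_def using m
    by (subst sum.union_disjoint[symmetric]) (auto intro!: sum.cong)
  have low: "dotp M u h = dotp M u (x m)" "dotp M h u = dotp M (x m) u" if "\<And>a. m \<le> a \<Longrightarrow> a < M \<Longrightarrow> u a = 0" for u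
    unfolding split using that by (auto simp: h_def)
  have "dotp M h h = dotp M (x m) (x m)"
  proof -
    have "(\<Sum>a\<in>{m..<M}. h a * cnj (h a)) = (\<Sum>a\<in>{m}. h a * cnj (h a))"
      using m by (intro sum.mono_neutral_right) (auto simp: h_def)
    also have "\<dots> = of_real (r\<^sup>2)" by (simp add: h_def power2_eq_square)
    also have "\<dots> = (\<Sum>a\<in>{m..<M}. x m a * cnj (x m a))"
      unfolding r2 tail_norm_def by (simp only: of_real_sum complex_norm_square)
    finally show ?thesis unfolding split by (simp add: h_def)
  qed
  then have "dotp M (?x i) (?x j) = dotp M (x i) (x j)" if "i < Suc m" "j < Suc m" for i j
    using that x low[of "x i"] low[of "x j"] by (cases "i = m"; cases "j = m") auto
  then have "gram M (Suc m) x = gram M (Suc m) ?x" by (auto simp: gram_def intro!: eq_matI)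
  then have "gdet M (Suc m) x = gdet M (Suc m) ?x" by (simp only: gdet_def)
  also have "\<dots> = (\<Prod>j<Suc m. (cmod (?x j j))\<^sup>2)"
    using m x by (intro gdet_triangular) (auto simp: h_def less_Suc_eq)
  also have "\<dots> = (\<Prod>j<m. (cmod (x j j))\<^sup>2) * r\<^sup>2" by (simp add: h_def)
  also have "(\<Prod>j<m. (cmod (x j j))\<^sup>2) = gdet M m x"
    using m x by (intro gdet_triangular[symmetric]) auto
  finally show ?thesis by (simp add: r2)
qed

text \<open>The rows of \<open>x\<close> before \<open>m\<close> are constants here, so the isometry
  triangularising them is one fixed map \<open>T\<close>. It turns the determinant into a function
  of \<open>T h\<close>, and invariance of the Gaussian law replaces \<open>T h\<close> by
  \<open>h\<close>.\<close>

lemma nn_integral_gdet_Suc: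
  fixes \<phi> :: "real \<Rightarrow> ennreal"
  assumes m: "m < M" and [measurable]: "\<phi> \<in> borel_measurable borel"
  shows "(\<integral>\<^sup>+h. \<phi> (gdet M (Suc m) (x(m := h))) \<partial>gauss_vec M) = (\<integral>\<^sup>+h. \<phi> (gdet M m x * tail_norm m M h) \<partial>gauss_vec M)"
proof -
  obtain T where T: "gauss_isometry M T" "\<And>j a. j < m \<Longrightarrow> j < a \<Longrightarrow> a < M \<Longrightarrow> T (x j) a = 0"
    using exists_isometry_triangular[of m M x] m by auto
  have "gdet M (Suc m) (x(m := h)) = gdet M m x * tail_norm m M (T h)" for h
  proof -
    have "gdet M (Suc m) (x(m := h)) = gdet M (Suc m) (\<lambda>i. T ((x(m := h)) i))"
      by (simp only: gdet_def gram_isometry[OF T(1)])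
    also have "\<dots> = gdet M m (\<lambda>i. T ((x(m := h)) i)) * tail_norm m M (T ((x(m := h)) m))"
      using T(2) by (intro gdet_Suc_triangular[OF m]) auto
    also have "gdet M m (\<lambda>i. T ((x(m := h)) i)) = gdet M m (x(m := h))"
      by (simp only: gdet_def gram_isometry[OF T(1)])
    also have "\<dots> = gdet M m x"
      unfolding gdet_def by (intro arg_cong[where f = "\<lambda>A. Re (det A)"] gram_cong) auto
    finally show ?thesis by (simp only: fun_upd_same)
  qed
  then have "(\<integral>\<^sup>+h. \<phi> (gdet M (Suc m) (x(m := h))) \<partial>gauss_vec M) = (\<integral>\<^sup>+h. \<phi> (gdet M m x * tail_norm m M (T h)) \<partial>gauss_vec M)"
    by simp
  also have "\<dots> = (\<integral>\<^sup>+h. \<phi> (gdet M m x * tail_norm m M h) \<partial>gauss_vec M)"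
    by (rule gauss_isometry_nn_integral[OF T(1)]) measurable
  finally show ?thesis .
qed

text \<open>The sum runs over \<open>M - m\<close> independent exponentials; the Erlang index is one
  less than their number.\<close>

lemma distributed_tail_norm:
  assumes m: "m < M"
  shows "distributed (gauss_vec M) lborel (tail_norm m M) (erlang_density (M - m - 1) 1)"
proof -
  interpret prob_space "gauss_vec M" by (rule prob_space_gauss_vec)
  have comp: "distr (gauss_vec M) complex_gaussian (\<lambda>h. h a) = complex_gaussian" if "a < M" for a
    unfolding gauss_vec_def using that by (intro gauss_prod.PiM_component) simp
  have exp: "distributed (gauss_vec M) lborel (\<lambda>h. (cmod (h a))\<^sup>2) (exponential_density 1)" if "a \<in> {m..<M}" for a
  proof -
    have a: "a < M" using that by simp
    have ma: "(\<lambda>h. h a) \<in> measurable (gauss_vec M) complex_gaussian"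
      using measurable_gauss_vec_component[OF a] by (simp cong: measurable_cong_sets)
    have "distr (gauss_vec M) lborel (\<lambda>h. (cmod (h a))\<^sup>2) = distr (distr (gauss_vec M) complex_gaussian (\<lambda>h. h a)) lborel (\<lambda>z. (cmod z)\<^sup>2)"
      using ma by (subst distr_distr) (auto simp: comp_def cong: measurable_cong_sets)
    also have "\<dots> = density lborel (exponential_density 1)"
      unfolding comp[OF a] using distributed_complex_gaussian_norm_square by (simp add: distributed_def)
    finally show ?thesis using measurable_gauss_vec_component[OF a] by (auto simp: distributed_def)
  qed
  have "indep_vars (\<lambda>_. complex_gaussian) (\<lambda>a h. h a) {..<M}"
  proof (subst indep_vars_iff_distr_eq_PiM')
    show "{..<M} \<noteq> {}" using m by auto
    show "random_variable complex_gaussian (\<lambda>h. h a)" if "a \<in> {..<M}" for a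
      using that measurable_gauss_vec_component[of a M] by (simp cong: measurable_cong_sets)
    have "distr (gauss_vec M) (Pi\<^sub>M {..<M} (\<lambda>_. complex_gaussian)) (\<lambda>h. \<lambda>a\<in>{..<M}. h a)
        = distr (gauss_vec M) (gauss_vec M) (\<lambda>h. h)"
      unfolding gauss_vec_def
      by (intro distr_cong) (auto simp: space_PiM PiE_def restrict_def extensional_def fun_eq_iff)
    also have "\<dots> = gauss_vec M" by (rule distr_id)
    also have "\<dots> = Pi\<^sub>M {..<M} (\<lambda>a. distr (gauss_vec M) complex_gaussian (\<lambda>h. h a))"
      by (subst gauss_vec_def) (intro PiM_cong, auto simp: comp)
    finally show "distr (gauss_vec M) (Pi\<^sub>M {..<M} (\<lambda>_. complex_gaussian)) (\<lambda>h. \<lambda>a\<in>{..<M}. h a)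
        = Pi\<^sub>M {..<M} (\<lambda>a. distr (gauss_vec M) complex_gaussian (\<lambda>h. h a))" .
  qed
  then have "indep_vars (\<lambda>_. borel) (\<lambda>a h. (cmod (h a))\<^sup>2) {..<M}"
    by (rule indep_vars_compose2) (auto cong: measurable_cong_sets)
  then have "indep_vars (\<lambda>_. borel) (\<lambda>a h. (cmod (h a))\<^sup>2) {m..<M}"
    by (rule indep_vars_subset) auto
  then have "distributed (gauss_vec M) lborel (\<lambda>h. \<Sum>a\<in>{m..<M}. (cmod (h a))\<^sup>2) (erlang_density (card {m..<M} - 1) 1)"
    using m exp by (intro exponential_distributed_sum) auto
  then show ?thesis by (simp add: tail_norm_def[abs_def])
qed

lemma tail_norm_ln:
  assumes m: "m < M"
  shows "has_bochner_integral (gauss_vec M) (\<lambda>h. ln (tail_norm m M h)) (erlang_ln (M - m - 1))"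
    and "AE h in gauss_vec M. tail_norm m M h > 0"
proof -
  note D = distributed_tail_norm[OF m]
  show "has_bochner_integral (gauss_vec M) (\<lambda>h. ln (tail_norm m M h)) (erlang_ln (M - m - 1))"
    unfolding has_bochner_integral_iff erlang_ln_def
    using distributed_integrable[OF D, of ln] distributed_integral[OF D, of ln] integrable_erlang_ln by auto
  have "AE x in density lborel (erlang_density (M - m - 1) 1). x > 0"
    using AE_lborel_singleton[of 0]
    by (subst AE_density) (auto simp: erlang_density_def elim!: eventually_mono)
  then have "AE x in distr (gauss_vec M) lborel (tail_norm m M). x > 0"
    using D by (simp only: distributed_def)
  then show "AE h in gauss_vec M. tail_norm m M h > 0"
    by (subst (asm) AE_distr_iff) auto
qed

subsection \<open>The law of the Gram determinant\<close>

lemma has_bochner_integral_distr_iff: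
  fixes f :: "_ \<Rightarrow> real"
  assumes "f \<in> borel_measurable N" "g \<in> measurable M N"
  shows "has_bochner_integral (distr M N g) f c \<longleftrightarrow> has_bochner_integral M (\<lambda>x. f (g x)) c"
  using assms by (simp add: has_bochner_integral_iff integrable_distr_eq integral_distr)

definition gauss_mat :: "nat set \<Rightarrow> nat \<Rightarrow> (nat \<times> nat \<Rightarrow> complex) measure" where
  "gauss_mat I M = PiM (I \<times> {..<M}) (\<lambda>_. complex_gaussian)"

lemma prob_space_gauss_mat: "prob_space (gauss_mat I M)"
  unfolding gauss_mat_def by (rule prob_space_PiM) (rule prob_space_complex_gaussian)

lemma measurable_gauss_mat_component:
  "i \<in> I \<Longrightarrow> a < M \<Longrightarrow> (\<lambda>H. H (i, a)) \<in> borel_measurable (gauss_mat I M)"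
proof -
  assume "i \<in> I" "a < M"
  then have "(\<lambda>H. H (i, a)) \<in> measurable (gauss_mat I M) complex_gaussian"
    unfolding gauss_mat_def by (intro measurable_component_singleton) simp
  then show ?thesis by (simp cong: measurable_cong_sets)
qed

text \<open>By the Leibniz formula the determinant is a polynomial in the inner products.\<close>

lemma gdet_measurable:
  assumes "\<And>i a. i < m \<Longrightarrow> a < M \<Longrightarrow> (\<lambda>w. x w i a) \<in> borel_measurable N"
  shows "(\<lambda>w. gdet M m (x w)) \<in> borel_measurable N"
proof -
  have dot: "(\<lambda>w. dotp M (x w i) (x w j)) \<in> borel_measurable N" if "i < m" "j < m" for i j
    unfolding dotp_def using that assms
    by (intro borel_measurable_sum borel_measurable_times borel_measurable_continuous_onI[of cnj, THEN measurable_compose_rev] continuous_intros) auto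
  have perm: "p i < m" if "p permutes {0..<m}" "i < m" for p i
    using permutes_in_image[OF that(1), of i] that(2) by simp
  have "(\<lambda>w. \<Sum>p\<in>{p. p permutes {0..<m}}. signof p * (\<Prod>i = 0..<m. dotp M (x w i) (x w (p i)))) \<in> borel_measurable N"
    by (intro borel_measurable_sum borel_measurable_times borel_measurable_prod dot borel_measurable_const)
       (auto simp: perm)
  also have "(\<lambda>w. \<Sum>p\<in>{p. p permutes {0..<m}}. signof p * (\<Prod>i = 0..<m. dotp M (x w i) (x w (p i)))) =
     (\<lambda>w. det (gram M m (x w)))"
    by (intro ext, subst det_def'[OF gram_carrier]) (auto simp: gram_def perm intro!: sum.cong prod.cong)
  finally show ?thesis unfolding gdet_def by measurable
qed

text \<open>Fubini for the last row. The hypothesis \<open>cong\<close> says that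
  \<open>\<psi>\<close> reads only entries of the index set, so the merged, restricted and
  case-split ways of gluing \<open>h\<close> to \<open>H\<close> can be exchanged.\<close>

lemma nn_integral_gauss_mat_Suc:
  fixes \<psi> :: "(nat \<times> nat \<Rightarrow> complex) \<Rightarrow> ennreal"
  assumes \<psi>: "\<psi> \<in> borel_measurable (gauss_mat {..<Suc m} M)"
    and cong: "\<And>H H'. (\<And>i a. i < Suc m \<Longrightarrow> a < M \<Longrightarrow> H (i, a) = H' (i, a)) \<Longrightarrow> \<psi> H = \<psi> H'"
  shows "(\<integral>\<^sup>+H. \<psi> H \<partial>gauss_mat {..<Suc m} M) =
    (\<integral>\<^sup>+H. \<integral>\<^sup>+h. \<psi> (\<lambda>(i, a). if i = m then h a else H (i, a)) \<partial>gauss_vec M \<partial>gauss_mat {..<m} M)"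
proof -
  let ?I = "{..<m} \<times> {..<M}" and ?J = "{m} \<times> {..<M}"
  have un: "{..<Suc m} \<times> {..<M} = ?I \<union> ?J" by auto
  have "(\<integral>\<^sup>+H. \<psi> H \<partial>gauss_mat {..<Suc m} M) =
    (\<integral>\<^sup>+H. \<integral>\<^sup>+G. \<psi> (merge ?I ?J (H, G)) \<partial>(PiM ?J (\<lambda>_. complex_gaussian)) \<partial>gauss_mat {..<m} M)"
    using \<psi> unfolding gauss_mat_def un
    by (intro gauss_prod.product_nn_integral_fold) auto
  also have "\<dots> = (\<integral>\<^sup>+H. \<integral>\<^sup>+h. \<psi> (\<lambda>(i, a). if i = m then h a else H (i, a)) \<partial>gauss_vec M \<partial>gauss_mat {..<m} M)"
  proof (rule nn_integral_cong)
    fix H assume H: "H \<in> space (gauss_mat {..<m} M)"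
    have reindex: "distr (PiM ?J (\<lambda>_. complex_gaussian)) (gauss_vec M) (\<lambda>G. \<lambda>a\<in>{..<M}. G (m, a)) = gauss_vec M"
      unfolding gauss_vec_def
      by (rule distr_PiM_reindex) (auto simp: inj_on_def prob_space_complex_gaussian)
    have "(\<integral>\<^sup>+h. \<psi> (\<lambda>(i, a). if i = m then h a else H (i, a)) \<partial>gauss_vec M)
      = (\<integral>\<^sup>+h. \<psi> (\<lambda>(i, a). if i = m then h a else H (i, a))
           \<partial>(distr (PiM ?J (\<lambda>_. complex_gaussian)) (gauss_vec M) (\<lambda>G. \<lambda>a\<in>{..<M}. G (m, a))))"
      by (simp only: reindex)
    also have "\<dots> = (\<integral>\<^sup>+G. \<psi> (\<lambda>(i, a). if i = m then (\<lambda>a\<in>{..<M}. G (m, a)) a else H (i, a)) \<partial>(PiM ?J (\<lambda>_. complex_gaussian)))"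
    proof -
      have m1: "(\<lambda>G. \<lambda>a\<in>{..<M}. G (m, a)) \<in> measurable (PiM ?J (\<lambda>_. complex_gaussian)) (gauss_vec M)"
        unfolding gauss_vec_def by (intro measurable_restrict measurable_component_singleton) auto
      let ?g = "\<lambda>h. \<lambda>p\<in>{..<Suc m} \<times> {..<M}. if fst p = m then h (snd p) else H p"
      have "?g \<in> measurable (gauss_vec M) (gauss_mat {..<Suc m} M)"
        unfolding gauss_mat_def
      proof (rule measurable_restrict)
        fix p :: "nat \<times> nat" assume "p \<in> {..<Suc m} \<times> {..<M}"
        then have "(\<lambda>h. if fst p = m then h (snd p) else H p) \<in> borel_measurable (gauss_vec M)"
          by (cases "fst p = m") (auto intro: measurable_gauss_vec_component)
        then show "(\<lambda>h. if fst p = m then h (snd p) else H p) \<in> measurable (gauss_vec M) complex_gaussian"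
          by (simp cong: measurable_cong_sets)
      qed
      then have "(\<lambda>h. \<psi> (?g h)) \<in> borel_measurable (gauss_vec M)"
        by (rule measurable_compose) (rule \<psi>)
      also have "(\<lambda>h. \<psi> (?g h)) = (\<lambda>h. \<psi> (\<lambda>(i, a). if i = m then h a else H (i, a)))"
        by (intro ext cong) auto
      finally have "(\<lambda>h. \<psi> (\<lambda>(i, a). if i = m then h a else H (i, a))) \<in> borel_measurable (gauss_vec M)" .
      then show ?thesis by (subst nn_integral_distr[OF m1]) auto
    qed
    also have "\<dots> = (\<integral>\<^sup>+G. \<psi> (merge ?I ?J (H, G)) \<partial>(PiM ?J (\<lambda>_. complex_gaussian)))"
      by (intro nn_integral_cong cong) (auto simp: merge_def less_Suc_eq)
    finally show "(\<integral>\<^sup>+G. \<psi> (merge ?I ?J (H, G)) \<partial>(PiM ?J (\<lambda>_. complex_gaussian)))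
      = (\<integral>\<^sup>+h. \<psi> (\<lambda>(i, a). if i = m then h a else H (i, a)) \<partial>gauss_vec M)" ..
  qed
  finally show ?thesis .
qed

lemma gdet_curry_measurable:
  "(\<lambda>H. gdet M m (curry H)) \<in> borel_measurable (gauss_mat {..<m} M)"
  by (rule gdet_measurable) (auto intro: measurable_gauss_mat_component)

text \<open>An equality of laws, not of random variables: the rotation behind it varies with the
  first \<open>m\<close> rows. It is tested on indicators, where the identity for frozen rows is
  integrated over those rows.\<close>

lemma distr_gdet_Suc:
  assumes m: "m < M"
  shows "distr (gauss_mat {..<Suc m} M) borel (\<lambda>H. gdet M (Suc m) (curry H)) =
    distr (gauss_mat {..<m} M \<Otimes>\<^sub>M gauss_vec M) borel (\<lambda>(H, h). gdet M m (curry H) * tail_norm m M h)"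
    (is "?L = ?R")
proof (rule measure_eqI)
  note [measurable] = gdet_curry_measurable
  interpret V: prob_space "gauss_vec M" by (rule prob_space_gauss_vec)
  fix A assume "A \<in> sets ?L"
  then have A[measurable]: "A \<in> sets borel" by simp
  have [measurable]: "(\<lambda>x. indicator A x :: ennreal) \<in> borel_measurable borel" by simp
  have "emeasure ?L A = (\<integral>\<^sup>+H. indicator A (gdet M (Suc m) (curry H)) \<partial>gauss_mat {..<Suc m} M)"
    by (subst nn_integral_indicator[symmetric], simp, subst nn_integral_distr) auto
  also have "\<dots> = (\<integral>\<^sup>+H. \<integral>\<^sup>+h. indicator A (gdet M (Suc m) (curry (\<lambda>(i, a). if i = m then h a else H (i, a)))) \<partial>gauss_vec M \<partial>gauss_mat {..<m} M)"
  proof (rule nn_integral_gauss_mat_Suc)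
    show "(\<lambda>H. indicator A (gdet M (Suc m) (curry H)) :: ennreal) \<in> borel_measurable (gauss_mat {..<Suc m} M)"
      by measurable
    show "(indicator A (gdet M (Suc m) (curry H)) :: ennreal) = indicator A (gdet M (Suc m) (curry H'))"
      if "\<And>i a. i < Suc m \<Longrightarrow> a < M \<Longrightarrow> H (i, a) = H' (i, a)" for H H'
    proof -
      have "gram M (Suc m) (curry H) = gram M (Suc m) (curry H')" using that by (intro gram_cong) auto
      then show ?thesis by (simp add: gdet_def)
    qed
  qed
  also have "\<dots> = (\<integral>\<^sup>+H. \<integral>\<^sup>+h. indicator A (gdet M (Suc m) ((curry H)(m := h))) \<partial>gauss_vec M \<partial>gauss_mat {..<m} M)"
    by (intro nn_integral_cong arg_cong[where f = "\<lambda>x. indicator A (gdet M (Suc m) x)"]) (auto simp: fun_eq_iff)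
  also have "\<dots> = (\<integral>\<^sup>+H. \<integral>\<^sup>+h. indicator A (gdet M m (curry H) * tail_norm m M h) \<partial>gauss_vec M \<partial>gauss_mat {..<m} M)"
    by (rule nn_integral_cong, rule nn_integral_gdet_Suc[OF m]) measurable
  also have "\<dots> = (\<integral>\<^sup>+p. indicator A (gdet M m (curry (fst p)) * tail_norm m M (snd p)) \<partial>(gauss_mat {..<m} M \<Otimes>\<^sub>M gauss_vec M))"
    by (subst V.nn_integral_fst[symmetric]) auto
  also have "\<dots> = emeasure ?R A"
    by (subst nn_integral_indicator[symmetric], simp, subst nn_integral_distr) (auto simp: case_prod_beta')
  finally show "emeasure ?L A = emeasure ?R A" .
qed simp

text \<open>Almost sure positivity is carried through the induction together with the integral,
  because splitting \<open>ln\<close> of the product in the step rests on it.\<close>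

lemma expectation_ln_gdet:
  assumes "m \<le> M"
  shows "has_bochner_integral (gauss_mat {..<m} M) (\<lambda>H. ln (gdet M m (curry H))) (\<Sum>j<m. erlang_ln (M - j - 1)) \<and>
    (AE H in gauss_mat {..<m} M. gdet M m (curry H) > 0)"
  using assms
proof (induction m)
  case 0
  interpret prob_space "gauss_mat {} M" by (rule prob_space_gauss_mat)
  have "gdet M 0 x = 1" for x by (simp add: gdet_def)
  then show ?case by (simp add: has_bochner_integral_iff)
next
  case (Suc m)
  then have m: "m < M" by simp
  note [measurable] = gdet_curry_measurable
  let ?A = "gauss_mat {..<m} M" and ?B = "gauss_vec M"
  interpret V: prob_space ?B by (rule prob_space_gauss_vec)
  interpret A: prob_space ?A by (rule prob_space_gauss_mat)
  interpret P: pair_prob_space ?A ?B ..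
  have IH: "has_bochner_integral ?A (\<lambda>H. ln (gdet M m (curry H))) (\<Sum>j<m. erlang_ln (M - j - 1))"
    "AE H in ?A. gdet M m (curry H) > 0"
    using Suc.IH[OF less_imp_le[OF m]] by blast+
  note W = tail_norm_ln[OF m]
  have fst: "distr (?A \<Otimes>\<^sub>M ?B) ?A fst = ?A" by (rule V.distr_pair_fst)
  have snd: "distr (?A \<Otimes>\<^sub>M ?B) ?B snd = ?B"
  proof (rule measure_eqI)
    fix X assume "X \<in> sets (distr (?A \<Otimes>\<^sub>M ?B) ?B snd)"
    then have X: "X \<in> sets ?B" by simp
    then have "emeasure (distr (?A \<Otimes>\<^sub>M ?B) ?B snd) X = emeasure (?A \<Otimes>\<^sub>M ?B) (space ?A \<times> X)"
      by (auto simp: emeasure_distr space_pair_measure dest: sets.sets_into_space intro!: arg_cong2[where f = emeasure])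
    also have "\<dots> = emeasure ?B X"
      using X by (simp add: V.emeasure_pair_measure_Times A.emeasure_space_1)
    finally show "emeasure (distr (?A \<Otimes>\<^sub>M ?B) ?B snd) X = emeasure ?B X" .
  qed simp
  have i1: "has_bochner_integral (?A \<Otimes>\<^sub>M ?B) (\<lambda>p. ln (gdet M m (curry (fst p)))) (\<Sum>j<m. erlang_ln (M - j - 1))"
    by (rule has_bochner_integral_distr_iff[where f = "\<lambda>H. ln (gdet M m (curry H))" and N = ?A, THEN iffD1])
       (simp_all only: fst IH(1), measurable)
  have i2: "has_bochner_integral (?A \<Otimes>\<^sub>M ?B) (\<lambda>p. ln (tail_norm m M (snd p))) (erlang_ln (M - m - 1))"
    by (rule has_bochner_integral_distr_iff[where f = "\<lambda>h. ln (tail_norm m M h)" and N = ?B, THEN iffD1])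
       (simp_all only: snd W(1), measurable)
  have a1: "AE p in ?A \<Otimes>\<^sub>M ?B. gdet M m (curry (fst p)) > 0"
    using IH(2) by (subst (asm) fst[symmetric]) (auto simp: AE_distr_iff)
  have a2: "AE p in ?A \<Otimes>\<^sub>M ?B. tail_norm m M (snd p) > 0"
    using W(2) by (subst (asm) snd[symmetric]) (auto simp: AE_distr_iff)
  let ?C = "gauss_mat {..<Suc m} M"
  have "has_bochner_integral (?A \<Otimes>\<^sub>M ?B) (\<lambda>p. ln (gdet M m (curry (fst p)) * tail_norm m M (snd p)))
    ((\<Sum>j<m. erlang_ln (M - j - 1)) + erlang_ln (M - m - 1))"
  proof (rule has_bochner_integral_cong_AE[THEN iffD1, OF _ _ _ has_bochner_integral_add[OF i1 i2]])
    show "AE p in ?A \<Otimes>\<^sub>M ?B. ln (gdet M m (curry (fst p))) + ln (tail_norm m M (snd p))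
        = ln (gdet M m (curry (fst p)) * tail_norm m M (snd p))"
      using a1 a2 by eventually_elim (simp add: ln_mult)
  qed measurable
  then have "has_bochner_integral (distr (?A \<Otimes>\<^sub>M ?B) borel (\<lambda>(H, h). gdet M m (curry H) * tail_norm m M h)) ln
      (\<Sum>j<Suc m. erlang_ln (M - j - 1))"
    by (subst has_bochner_integral_distr_iff) (auto simp: case_prod_beta')
  then have "has_bochner_integral ?C (\<lambda>H. ln (gdet M (Suc m) (curry H))) (\<Sum>j<Suc m. erlang_ln (M - j - 1))"
    unfolding distr_gdet_Suc[OF m, symmetric] by (subst (asm) has_bochner_integral_distr_iff) auto
  moreover have "AE H in ?C. gdet M (Suc m) (curry H) > 0"
  proof -
    have "AE p in ?A \<Otimes>\<^sub>M ?B. gdet M m (curry (fst p)) * tail_norm m M (snd p) > 0"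
      using a1 a2 by eventually_elim simp
    then have "AE x in distr (?A \<Otimes>\<^sub>M ?B) borel (\<lambda>(H, h). gdet M m (curry H) * tail_norm m M h). x > 0"
      by (subst AE_distr_iff) (auto simp: case_prod_beta')
    then show ?thesis
      unfolding distr_gdet_Suc[OF m, symmetric] by (subst (asm) AE_distr_iff) auto
  qed
  ultimately show ?case by blast
qed

subsection \<open>Determinant inequalities\<close>

lemma mat_mult_entry:
  assumes "X \<in> carrier_mat n m" "Y \<in> carrier_mat m l" "i < n" "j < l"
  shows "(X * Y) $$ (i, j) = (\<Sum>k<m. X $$ (i, k) * Y $$ (k, j))"
  using assms by (simp add: scalar_prod_def atLeast0LessThan)

text \<open>\<open>?U\<close> has determinant one. Multiplying \<open>?F\<close> by it on the right
  or on the left clears the upper right block, but leaves \<open>B * A\<close> in one diagonal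
  corner and \<open>A * B\<close> in the other.\<close>

lemma sylvester_det:
  fixes A B :: "complex mat"
  assumes A: "A \<in> carrier_mat n m" and B: "B \<in> carrier_mat m n"
  shows "det (1\<^sub>m n + A * B) = det (1\<^sub>m m + B * A)"
proof -
  let ?F = "four_block_mat (1\<^sub>m n) (- A) B (1\<^sub>m m)"
  let ?U = "four_block_mat (1\<^sub>m n) A (0\<^sub>m m n) (1\<^sub>m m)"
  have F: "?F \<in> carrier_mat (n + m) (n + m)" and U: "?U \<in> carrier_mat (n + m) (n + m)"
    using A B by auto
  have detU: "det ?U = 1"
    using A by (subst det_four_block_mat_lower_left_zero) auto
  have "?F * ?U = four_block_mat (1\<^sub>m n) (0\<^sub>m n m) B (1\<^sub>m m + B * A)"
    using A B by (subst mult_four_block_mat[OF _ _ _ _ _ _ _ _]) (auto intro!: arg_cong2[where f = "four_block_mat _ _"] simp: comm_add_mat)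
  then have "det (?F * ?U) = det (1\<^sub>m m + B * A)"
    using A B by (simp only:) (subst det_four_block_mat_upper_right_zero; auto)
  moreover have "?U * ?F = four_block_mat (1\<^sub>m n + A * B) (0\<^sub>m n m) B (1\<^sub>m m)"
    using A B by (subst mult_four_block_mat) auto
  then have "det (?U * ?F) = det (1\<^sub>m n + A * B)"
    using A B by (simp only:) (subst det_four_block_mat_upper_right_zero; auto)
  ultimately show ?thesis using det_mult[OF F U] det_mult[OF U F] detU by simp
qed

lemma am_gm:
  fixes x :: "'a \<Rightarrow> real"
  assumes "finite S" "S \<noteq> {}" "\<And>i. i \<in> S \<Longrightarrow> x i \<ge> 0"
  shows "(\<Prod>i\<in>S. x i) \<le> ((\<Sum>i\<in>S. x i) / card S) ^ card S"
proof -
  have c: "card S > 0" using assms by (simp add: card_gt_0_iff)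
  have p: "(\<Prod>i\<in>S. x i) \<ge> 0" using assms by (simp add: prod_nonneg)
  have "(\<Prod>i\<in>S. x i) = ((\<Prod>i\<in>S. x i) powr (1 / card S)) ^ card S"
    using c p by (cases "(\<Prod>i\<in>S. x i) = 0") (simp_all add: powr_power)
  also have "\<dots> \<le> ((\<Sum>i\<in>S. x i) / card S) ^ card S"
    using arith_geom_mean[OF assms(1,2), of x] assms(3) by (intro power_mono) (auto simp: sum_divide_distrib)
  finally show ?thesis .
qed

text \<open>At an eigenvector \<open>v\<close> the quadratic form \<open>q\<close> is real by
  symmetry, nonnegative, and equal to \<open>e\<close> times the squared norm of
  \<open>v\<close>.\<close>

lemma psd_eigenvalue:
  assumes A: "A \<in> carrier_mat n n" and psd: "psd n (\<lambda>i j. A $$ (i, j))" and ev: "eigenvalue A e"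
  shows "e = of_real (Re e) \<and> Re e \<ge> 0"
proof -
  obtain v where v: "v \<in> carrier_vec n" "v \<noteq> 0\<^sub>v n" "A *\<^sub>v v = e \<cdot>\<^sub>v v"
    using ev A by (auto simp: eigenvalue_def eigenvector_def)
  define q where "q = (\<Sum>i<n. \<Sum>j<n. cnj (v $ i) * A $$ (i, j) * v $ j)"
  define s where "s = (\<Sum>i<n. (cmod (v $ i))\<^sup>2)"
  have q0: "Re q \<ge> 0" using psd unfolding psd_def q_def by blast
  have herm: "cnj (A $$ (i, j)) = A $$ (j, i)" if "i < n" "j < n" for i j
    using psd that unfolding psd_def by metis
  have "cnj q = (\<Sum>i<n. \<Sum>j<n. v $ i * A $$ (j, i) * cnj (v $ j))"
    unfolding q_def cnj_sum by (intro sum.cong refl) (simp add: herm)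
  also have "\<dots> = q"
    unfolding q_def by (subst sum.swap) (simp add: mult_ac)
  finally have qr: "q = of_real (Re q)" by (metis Reals_cnj_iff of_real_Re)
  have Av: "(\<Sum>j<n. A $$ (i, j) * v $ j) = e * v $ i" if "i < n" for i
  proof -
    have "(A *\<^sub>v v) $ i = (\<Sum>j<n. A $$ (i, j) * v $ j)"
      using that A v(1) by (simp add: scalar_prod_def atLeast0LessThan)
    then show ?thesis using v(1,3) that by simp
  qed
  have "q = (\<Sum>i<n. cnj (v $ i) * (\<Sum>j<n. A $$ (i, j) * v $ j))"
    by (simp add: q_def sum_distrib_left mult.assoc)
  also have "\<dots> = (\<Sum>i<n. e * (v $ i * cnj (v $ i)))"
    by (intro sum.cong refl, subst Av) (simp_all add: mult_ac)
  also have "\<dots> = e * of_real s"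
    unfolding s_def by (simp only: sum_distrib_left of_real_sum complex_norm_square)
  finally have qe: "q = e * of_real s" .
  have "\<exists>i<n. v $ i \<noteq> 0" using v(1,2) by (auto intro: eq_vecI)
  then have s: "s > 0"
    unfolding s_def by (auto intro!: sum_pos2)
  have "e = of_real (Re q / s)" using qe qr s by (simp add: field_simps)
  moreover have "Re q / s \<ge> 0" using q0 s by simp
  ultimately show ?thesis by simp
qed

text \<open>A Schur form is enough, no diagonalisation: the diagonal of the triangular matrix
  \<open>B\<close> consists of eigenvalues, with product the determinant and sum the trace, and
  AM-GM compares the two.\<close>

lemma psd_det_le:
  assumes A: "A \<in> carrier_mat n n" and psd: "psd n (\<lambda>i j. A $$ (i, j))" and n: "n > 0"
  shows "Re (det A) \<ge> 0" and "Re (det A) \<le> (Re (\<Sum>i<n. A $$ (i, i)) / n) ^ n"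
proof -
  obtain es where es: "char_poly A = (\<Prod>a\<leftarrow>es. [:- a, 1:])"
    using char_poly_factorized[OF A] by auto
  obtain B P Q where BPQ: "schur_decomposition A es = (B, P, Q)" by (cases "schur_decomposition A es")
  have sim: "similar_mat_wit A B P Q" and ut: "upper_triangular B"
    using schur_decomposition[OF A es BPQ] by auto
  note w = similar_mat_witD2[OF A sim]
  have B: "B \<in> carrier_mat n n" using w by auto
  have ev: "B $$ (i, i) = of_real (Re (B $$ (i, i))) \<and> Re (B $$ (i, i)) \<ge> 0" if "i < n" for i
  proof (rule psd_eigenvalue[OF A psd])
    have "B $$ (i, i) \<in> set (diag_mat B)" using that B by (auto simp: diag_mat_def)
    then have "poly (char_poly B) (B $$ (i, i)) = 0"
      unfolding char_poly_upper_triangular[OF B ut] by (force simp: poly_prod_list prod_list_zero_iff)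
    then show "eigenvalue A (B $$ (i, i))"
      unfolding eigenvalue_root_char_poly[OF A] using char_poly_similar[of A B] sim
      unfolding similar_mat_def by metis
  qed
  define r where "r i = Re (B $$ (i, i))" for i
  have Br: "B $$ (i, i) = of_real (r i)" "r i \<ge> 0" if "i < n" for i
    using ev[OF that] by (simp_all add: r_def)
  have "det A = det B" using sim by (intro det_similar) (auto simp: similar_mat_def)
  also have "\<dots> = prod_list (diag_mat B)" by (rule det_upper_triangular[OF ut B])
  also have "\<dots> = (\<Prod>i<n. B $$ (i, i))"
    using B by (simp add: diag_mat_def prod.list_conv_set_nth atLeast0LessThan)
  also have "\<dots> = of_real (\<Prod>i<n. r i)" by (simp add: Br)
  finally have det: "Re (det A) = (\<Prod>i<n. r i)" by (simp only: Re_complex_of_real)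
  then show "Re (det A) \<ge> 0" using Br by (auto intro!: prod_nonneg)
  have PB: "P * B \<in> carrier_mat n n" and P: "P \<in> carrier_mat n n" and Q: "Q \<in> carrier_mat n n"
    and A_eq: "A = P * B * Q" and QP: "Q * P = 1\<^sub>m n"
    using w by auto
  \<comment> \<open>Cyclicity of the trace, written out as an exchange of sums.\<close>
  have "(\<Sum>i<n. A $$ (i, i)) = (\<Sum>i<n. \<Sum>j<n. (P * B) $$ (i, j) * Q $$ (j, i))"
    unfolding A_eq by (intro sum.cong refl mat_mult_entry[OF PB Q]) auto
  also have "\<dots> = (\<Sum>j<n. \<Sum>i<n. Q $$ (j, i) * (P * B) $$ (i, j))"
    by (subst sum.swap) (simp add: mult.commute)
  also have "\<dots> = (\<Sum>j<n. (Q * (P * B)) $$ (j, j))"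
    by (intro sum.cong refl mat_mult_entry[OF Q PB, symmetric]) auto
  also have "Q * (P * B) = B"
    using assoc_mult_mat[OF Q P B] QP B by simp
  also have "(\<Sum>j<n. B $$ (j, j)) = of_real (\<Sum>i<n. r i)" by (simp add: Br)
  finally have tr: "Re (\<Sum>i<n. A $$ (i, i)) = (\<Sum>i<n. r i)" by (simp only: Re_complex_of_real)
  show "Re (det A) \<le> (Re (\<Sum>i<n. A $$ (i, i)) / n) ^ n"
    unfolding det tr using am_gm[of "{..<n}" r] n Br by auto
qed

lemma gram_psd: "psd n (\<lambda>i j. dotp M (z i) (z j))"
  unfolding psd_def
proof (intro conjI allI impI)
  show "dotp M (z j) (z i) = cnj (dotp M (z i) (z j))" for i j
    by (simp add: dotp_def mult.commute)
  fix x :: "nat \<Rightarrow> complex"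
  have "(\<Sum>i<n. \<Sum>j<n. cnj (x i) * dotp M (z i) (z j) * x j)
    = (\<Sum>i<n. \<Sum>j<n. \<Sum>a<M. (cnj (x i) * z i a) * cnj (cnj (x j) * z j a))"
    by (simp add: dotp_def sum_distrib_left sum_distrib_right mult_ac)
  also have "\<dots> = (\<Sum>i<n. \<Sum>a<M. \<Sum>j<n. (cnj (x i) * z i a) * cnj (cnj (x j) * z j a))"
    by (rule sum.cong[OF refl], rule sum.swap)
  also have "\<dots> = (\<Sum>a<M. \<Sum>i<n. \<Sum>j<n. (cnj (x i) * z i a) * cnj (cnj (x j) * z j a))"
    by (rule sum.swap)
  also have "\<dots> = (\<Sum>a<M. (\<Sum>i<n. cnj (x i) * z i a) * cnj (\<Sum>i<n. cnj (x i) * z i a))"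
    by (simp add: sum_product)
  also have "\<dots> = of_real (\<Sum>a<M. (cmod (\<Sum>i<n. cnj (x i) * z i a))\<^sup>2)"
    by (simp only: of_real_sum complex_norm_square)
  finally show "0 \<le> Re (\<Sum>i<n. \<Sum>j<n. cnj (x i) * dotp M (z i) (z j) * x j)"
    by (simp only: Re_complex_of_real) (simp add: sum_nonneg)
qed

subsection \<open>The dual basis and the zero-forcing gains\<close>

lemma sum_blocks:
  fixes f :: "nat \<Rightarrow> 'a::comm_monoid_add"
  shows "(\<Sum>k<K. \<Sum>n<N. f (k * N + n)) = (\<Sum>i<K * N. f i)"
proof -
  have "(\<Sum>n<N. f (k * N + n)) = sum f {k * N..<k * N + N}" for k
    using sum.shift_bounds_nat_ivl[of f 0 "k * N" N] by (simp add: atLeast0LessThan add.commute)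
  then show ?thesis by (simp add: sum.nat_group)
qed

lemma block_index: "n < N \<Longrightarrow> (k * N + n) div N = k" "n < N \<Longrightarrow> (k * N + n) mod N = n" for n N k :: nat
  by simp_all

text \<open>Translates between the per-user triple sums of \<open>dpc_matrix\<close> and double sums
  over stacked row indices.\<close>

lemma sum_block_diagonal:
  fixes g :: "nat \<Rightarrow> nat \<Rightarrow> 'a::comm_monoid_add"
  assumes "\<And>i j. i div N \<noteq> j div N \<Longrightarrow> g i j = 0"
  shows "(\<Sum>i<K * N. \<Sum>j<K * N. g i j) = (\<Sum>k<K. \<Sum>n<N. \<Sum>n'<N. g (k * N + n) (k * N + n'))"
proof -
  have "(\<Sum>i<K * N. \<Sum>j<K * N. g i j) = (\<Sum>k<K. \<Sum>n<N. \<Sum>k'<K. \<Sum>n'<N. g (k * N + n) (k' * N + n'))"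
    by (subst sum_blocks[symmetric]) (intro sum.cong refl sum_blocks[symmetric])
  also have "\<dots> = (\<Sum>k<K. \<Sum>n<N. \<Sum>k'<K. if k' = k then (\<Sum>n'<N. g (k * N + n) (k * N + n')) else 0)"
    using assms by (intro sum.cong refl) (auto simp: block_index intro!: sum.neutral)
  also have "\<dots> = (\<Sum>k<K. \<Sum>n<N. \<Sum>n'<N. g (k * N + n) (k * N + n'))"
    by (rule sum.cong[OF refl], rule sum.cong[OF refl]) (simp add: sum.delta)
  finally show ?thesis .
qed

lemma dotp_sum_left: "dotp M (\<lambda>a. \<Sum>k\<in>S. c k * x k a) y = (\<Sum>k\<in>S. c k * dotp M (x k) y)"
proof -
  have "dotp M (\<lambda>a. \<Sum>k\<in>S. c k * x k a) y = (\<Sum>a<M. \<Sum>k\<in>S. c k * (x k a * cnj (y a)))"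
    by (simp add: dotp_def sum_distrib_right mult.assoc)
  also have "\<dots> = (\<Sum>k\<in>S. \<Sum>a<M. c k * (x k a * cnj (y a)))" by (rule sum.swap)
  finally show ?thesis by (simp add: dotp_def sum_distrib_left)
qed

lemma cnj_dotp: "cnj (dotp M x y) = dotp M y x"
  by (simp add: dotp_def mult.commute)

lemma dotp_sum_right: "dotp M y (\<lambda>a. \<Sum>k\<in>S. c k * x k a) = (\<Sum>k\<in>S. cnj (c k) * dotp M y (x k))"
proof -
  have "dotp M y (\<lambda>a. \<Sum>k\<in>S. c k * x k a) = cnj (dotp M (\<lambda>a. \<Sum>k\<in>S. c k * x k a) y)"
    by (simp only: cnj_dotp)
  then show ?thesis by (simp add: dotp_sum_left cnj_dotp)
qed

text \<open>The Gram matrix of the dual basis is the inverse Gram matrix, which makes the latter visibly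
  positive semidefinite.\<close>

definition dual_coeff :: "nat \<Rightarrow> nat \<Rightarrow> (nat \<Rightarrow> nat \<Rightarrow> complex) \<Rightarrow> nat \<Rightarrow> nat \<Rightarrow> complex" where
  "dual_coeff M R x i k = cofactor (gram M R x) k i / det (gram M R x)"

definition dual_vec :: "nat \<Rightarrow> nat \<Rightarrow> (nat \<Rightarrow> nat \<Rightarrow> complex) \<Rightarrow> nat \<Rightarrow> nat \<Rightarrow> complex" where
  "dual_vec M R x i a = (\<Sum>k<R. dual_coeff M R x i k * x k a)"

text \<open>Biorthogonality is the adjugate identity, adj(G) G = det(G) 1, read entrywise.\<close>

lemma dotp_dual_vec:
  assumes d: "det (gram M R x) \<noteq> 0" and ij: "i < R" "j < R"
  shows "dotp M (dual_vec M R x i) (x j) = (if i = j then 1 else 0)"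
proof -
  let ?G = "gram M R x"
  have "dotp M (dual_vec M R x i) (x j) = (\<Sum>k<R. dual_coeff M R x i k * dotp M (x k) (x j))"
    unfolding dual_vec_def by (rule dotp_sum_left)
  also have "\<dots> = (adj_mat ?G * ?G) $$ (i, j) / det ?G"
    using ij adj_mat(1)[OF gram_carrier[of M R x]]
    by (simp add: scalar_prod_def atLeast0LessThan adj_mat_def dual_coeff_def sum_divide_distrib gram_def)
  also have "\<dots> = (if i = j then 1 else 0)"
    using d ij by (simp add: adj_mat(3)[OF gram_carrier])
  finally show ?thesis .
qed

lemma dotp_dual_vec_dual_vec:
  assumes d: "det (gram M R x) \<noteq> 0" and ij: "i < R" "j < R"
  shows "dotp M (dual_vec M R x i) (dual_vec M R x j) = dual_coeff M R x i j"
proof -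
  have *: "dotp M (dual_vec M R x i) (dual_vec M R x j) = cnj (dual_coeff M R x j i)" if "i < R" "j < R" for i j
  proof -
    have "dotp M (dual_vec M R x i) (dual_vec M R x j)
      = (\<Sum>k<R. cnj (dual_coeff M R x j k) * dotp M (dual_vec M R x i) (x k))"
      by (subst (2) dual_vec_def[abs_def]) (rule dotp_sum_right)
    also have "\<dots> = (\<Sum>k<R. if i = k then cnj (dual_coeff M R x j k) else 0)"
      using that by (intro sum.cong) (auto simp: dotp_dual_vec[OF d])
    finally show ?thesis using that by simp
  qed
  have "dotp M (dual_vec M R x i) (dual_vec M R x j) = cnj (dotp M (dual_vec M R x j) (dual_vec M R x i))"
    by (simp only: cnj_dotp)
  then show ?thesis using *[OF ij(2,1)] by simp
qed

text \<open>The index shift of \<open>mat_delete\<close>: composing a family of rows with it deletes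
  row \<open>i\<close>.\<close>

definition skip :: "nat \<Rightarrow> nat \<Rightarrow> nat" where
  "skip i j = (if j < i then j else Suc j)"

lemma dual_coeff_diag:
  assumes R: "R \<le> M" and i: "i < R"
  shows "dual_coeff M R x i i = of_real (gdet M (R - 1) (x \<circ> skip i) / gdet M R x)"
proof -
  have "mat_delete (gram M R x) i i = gram M (R - 1) (x \<circ> skip i)"
    using i by (intro eq_matI) (auto simp: mat_delete_def gram_def skip_def)
  then show ?thesis
    using R by (simp add: dual_coeff_def cofactor_def det_gram_real)
qed

text \<open>The projection is the dual vector \<open>z\<close> divided by \<open>b\<close>, the
  \<open>i\<close>-th diagonal entry of the inverse Gram matrix. The squared norm of
  \<open>z\<close> is \<open>b\<close> as well, so the squared gain is
  \<open>b / b\<^sup>2\<close>.\<close>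

lemma zf_gain_square:
  assumes R: "R \<le> M" and i: "i < R" and pos: "gdet M R (curry H) > 0" "gdet M (R - 1) (curry H \<circ> skip i) > 0"
  shows "(zf_gain R M H i)\<^sup>2 = gdet M R (curry H) / gdet M (R - 1) (curry H \<circ> skip i)"
proof -
  let ?x = "curry H"
  have d: "det (gram M R ?x) \<noteq> 0" using pos(1) R by (simp add: det_gram_real)
  define b where "b = gdet M (R - 1) (?x \<circ> skip i) / gdet M R ?x"
  have b: "b > 0" using pos by (simp add: b_def)
  have c: "dual_coeff M R ?x i i = of_real b" using dual_coeff_diag[OF R i] by (simp add: b_def)
  define z where "z = dual_vec M R ?x i"
  have zx: "dotp M z (?x j) = (if i = j then 1 else 0)" if "j < R" for j
    using dotp_dual_vec[OF d i that] by (simp add: z_def)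
  \<comment> \<open>\<open>z\<close> is orthogonal to all other rows and has coefficient
    \<open>b\<close> on row \<open>i\<close>; rescaling that coefficient to one puts row
    \<open>i\<close> minus \<open>p\<close> into the span of the others.\<close>
  define p where "p a = (if a < M then z a / of_real b else 0)" for a
  define c2 where "c2 j = - (dual_coeff M R ?x i j / of_real b)" for j
  have c2: "H (i, a) - p a = (\<Sum>j\<in>{..<R} - {i}. c2 j * H (j, a))" if "a < M" for a
  proof -
    have "z a = dual_coeff M R ?x i i * H (i, a) + (\<Sum>j\<in>{..<R} - {i}. dual_coeff M R ?x i j * H (j, a))"
      unfolding z_def dual_vec_def using i by (subst sum.remove[of _ i]) auto
    then have "p a = H (i, a) + (\<Sum>j\<in>{..<R} - {i}. dual_coeff M R ?x i j * H (j, a)) / of_real b"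
      using that b by (simp add: p_def c add_divide_distrib)
    then show ?thesis by (simp add: sum_negf sum_divide_distrib c2_def)
  qed
  have orth: "(\<Sum>a<M. p a * cnj (H (j, a))) = 0" if j: "j \<in> {..<R} - {i}" for j
  proof -
    have "(\<Sum>a<M. p a * cnj (H (j, a))) = dotp M z (?x j) / of_real b"
      by (simp add: p_def dotp_def sum_divide_distrib)
    then show ?thesis using zx j by simp
  qed
  have proj: "zf_proj R M H i = p"
    unfolding zf_proj_def
  proof (rule the_equality)
    show "(\<forall>a. M \<le> a \<longrightarrow> p a = 0) \<and>
      (\<exists>c. \<forall>a<M. H (i, a) - p a = (\<Sum>j\<in>{..<R} - {i}. c j * H (j, a))) \<and>
      (\<forall>j\<in>{..<R} - {i}. (\<Sum>a<M. p a * cnj (H (j, a))) = 0)"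
    proof (intro conjI)
      show "\<forall>a. M \<le> a \<longrightarrow> p a = 0" by (simp add: p_def)
      show "\<exists>c. \<forall>a<M. H (i, a) - p a = (\<Sum>j\<in>{..<R} - {i}. c j * H (j, a))"
        by (intro exI[of _ c2] allI impI c2)
      show "\<forall>j\<in>{..<R} - {i}. (\<Sum>a<M. p a * cnj (H (j, a))) = 0" using orth by blast
    qed
  next
    fix q
    assume q: "(\<forall>a. M \<le> a \<longrightarrow> q a = 0) \<and>
      (\<exists>c. \<forall>a<M. H (i, a) - q a = (\<Sum>j\<in>{..<R} - {i}. c j * H (j, a))) \<and>
      (\<forall>j\<in>{..<R} - {i}. (\<Sum>a<M. q a * cnj (H (j, a))) = 0)"
    then obtain c1 where c1: "\<And>a. a < M \<Longrightarrow> H (i, a) - q a = (\<Sum>j\<in>{..<R} - {i}. c1 j * H (j, a))" by auto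
    \<comment> \<open>Uniqueness: the difference of two candidates lies in the span of the other
      rows and is orthogonal to each of them, hence to itself.\<close>
    define e where "e a = p a - q a" for a
    have e0: "dotp M e (?x j) = 0" if j: "j \<in> {..<R} - {i}" for j
    proof -
      have "(\<Sum>a<M. q a * cnj (H (j, a))) = 0" using q j by blast
      then show ?thesis using orth[OF j] by (simp add: dotp_def e_def left_diff_distrib sum_subtractf)
    qed
    have e: "e a = (\<Sum>j\<in>{..<R} - {i}. (c1 j - c2 j) * ?x j a)" if "a < M" for a
      using c1[OF that] c2[OF that] by (simp add: e_def left_diff_distrib sum_subtractf algebra_simps)
    have "of_real (\<Sum>a<M. (cmod (e a))\<^sup>2) = dotp M e e"
      unfolding dotp_def by (simp only: of_real_sum complex_norm_square)
    also have "\<dots> = dotp M e (\<lambda>a. \<Sum>j\<in>{..<R} - {i}. (c1 j - c2 j) * ?x j a)"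
      unfolding dotp_def by (intro sum.cong refl arg_cong2[where f = "(*)"] arg_cong[where f = cnj] e) simp
    also have "\<dots> = 0"
      unfolding dotp_sum_right by (intro sum.neutral ballI) (simp only: e0 mult_zero_right)
    finally have "(\<Sum>a<M. (cmod (e a))\<^sup>2) = 0" by (simp only: of_real_eq_0_iff)
    then have "e a = 0" if "a < M" for a
      using that by (subst (asm) sum_nonneg_eq_0_iff) auto
    then show "q = p"
      using q by (intro ext) (metis e_def eq_iff_diff_eq_0 leI p_def)
  qed
  have "(zf_gain R M H i)\<^sup>2 = (\<Sum>a<M. (cmod (p a))\<^sup>2)"
    unfolding zf_gain_def proj by (simp add: sum_nonneg)
  also have "\<dots> = (\<Sum>a<M. (cmod (z a))\<^sup>2) / b\<^sup>2"
    using b by (simp add: p_def norm_divide power_divide sum_divide_distrib)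
  also have "(\<Sum>a<M. (cmod (z a))\<^sup>2) = b"
  proof -
    have "complex_of_real (\<Sum>a<M. (cmod (z a))\<^sup>2) = dotp M z z"
      unfolding dotp_def by (simp only: of_real_sum complex_norm_square)
    also have "\<dots> = of_real b" unfolding z_def dotp_dual_vec_dual_vec[OF d i i] c ..
    finally show ?thesis by (simp only: of_real_eq_iff)
  qed
  finally show ?thesis using b by (simp add: b_def power2_eq_square)
qed

subsection \<open>High-power asymptotics\<close>

text \<open>Both capacities are sandwiched between the rate of equal power allocation and the AM-GM
  bound; the two agree up to \<open>o(1)\<close>.\<close>

lemma capacity_limit:
  fixes C L :: "real \<Rightarrow> real"
  assumes n: "n > 0"
    and up: "\<forall>\<^sub>F P in at_top. C P \<le> c + n * log 2 ((D + P) / n)"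
    and lo: "\<forall>\<^sub>F P in at_top. L P \<le> C P"
    and L: "((\<lambda>P. L P - n * log 2 (P / n)) \<longlongrightarrow> c) at_top"
  shows "((\<lambda>P. C P - n * log 2 (P / n)) \<longlongrightarrow> c) at_top"
proof (rule tendsto_sandwich[OF _ _ L])
  show "\<forall>\<^sub>F P in at_top. L P - n * log 2 (P / n) \<le> C P - n * log 2 (P / n)"
    using lo by eventually_elim simp
  show "\<forall>\<^sub>F P in at_top. C P - n * log 2 (P / n) \<le> c + n * (log 2 ((D + P) / n) - log 2 (P / n))"
    using up by eventually_elim (simp add: algebra_simps)
  have "((\<lambda>P. log 2 ((D + P) / n) - log 2 (P / n)) \<longlongrightarrow> 0) at_top"
    using n by real_asymp
  from tendsto_add[OF tendsto_const tendsto_mult[OF tendsto_const this]]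
  show "((\<lambda>P. c + n * (log 2 ((D + P) / n) - log 2 (P / n))) \<longlongrightarrow> c) at_top" by simp
qed

text \<open>For large power the AM-GM bound also dominates the default value
  \<open>log 2 0 = 0\<close>.\<close>

lemma capacity_bound_nonneg:
  assumes n: "n > (0::real)"
  shows "\<forall>\<^sub>F P in at_top. c + n * log 2 ((D + P) / n) \<ge> 0"
proof -
  have "filterlim (\<lambda>P. c + n * log 2 ((D + P) / n)) at_top at_top"
    using n by real_asymp
  then show ?thesis by (simp add: filterlim_at_top)
qed

lemma tendsto_det:
  fixes f :: "'b \<Rightarrow> nat \<Rightarrow> nat \<Rightarrow> complex"
  assumes "\<And>i j. i < n \<Longrightarrow> j < n \<Longrightarrow> ((\<lambda>s. f s i j) \<longlongrightarrow> A i j) F"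
  shows "((\<lambda>s. det (mat n n (\<lambda>(i, j). f s i j))) \<longlongrightarrow> det (mat n n (\<lambda>(i, j). A i j))) F"
proof -
  have perm: "p i < n" if "p permutes {0..<n}" "i < n" for p i
    using permutes_in_image[OF that(1), of i] that(2) by simp
  have expand: "det (mat n n (\<lambda>(i, j). g i j)) = (\<Sum>p\<in>{p. p permutes {0..<n}}. signof p * (\<Prod>i = 0..<n. g i (p i)))"
    for g :: "nat \<Rightarrow> nat \<Rightarrow> complex"
    by (subst det_def'[of _ n]) (auto simp: perm intro!: sum.cong prod.cong)
  show ?thesis
    unfolding expand by (intro tendsto_sum tendsto_mult tendsto_const tendsto_prod assms) (auto simp: perm)
qed

text \<open>The block-diagonal matrix with the users' covariances as blocks, on stacked row
  indices.\<close>

definition block_entry :: "nat \<Rightarrow> (nat \<Rightarrow> nat \<Rightarrow> nat \<Rightarrow> complex) \<Rightarrow> nat \<Rightarrow> nat \<Rightarrow> complex" where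
  "block_entry N Q i j = (if i div N = j div N then Q (i div N) (i mod N) (j mod N) else 0)"

lemma det_dpc_matrix:
  assumes R: "R = K * N" and d: "det (gram M R (curry H)) \<noteq> 0"
  shows "det (dpc_matrix K N M H Q) = det (mat R R (\<lambda>(i, j).
      dotp M (dual_vec M R (curry H) i) (dual_vec M R (curry H) j) + block_entry N Q i j)) * det (gram M R (curry H))"
proof -
  let ?x = "curry H" and ?q = "block_entry N Q"
  let ?G = "gram M R ?x" and ?z = "dual_vec M R ?x"
  \<comment> \<open>\<open>S\<close> is the inverse Gram matrix plus the block covariance.
    \<open>A\<close> is the conjugate transpose of the channel and \<open>B\<close> the block
    covariance times the channel, so that \<open>A * B\<close> is the sum in
    \<open>dpc_matrix\<close>.\<close>
  define S where "S = mat R R (\<lambda>(i, j). dotp M (?z i) (?z j) + ?q i j)"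
  define A where "A = mat M R (\<lambda>(a, i). cnj (H (i, a)))"
  define B where "B = mat R M (\<lambda>(i, b). \<Sum>j<R. ?q i j * ?x j b)"
  have A: "A \<in> carrier_mat M R" and B: "B \<in> carrier_mat R M" and S: "S \<in> carrier_mat R R"
    by (auto simp: A_def B_def S_def)
  have "dpc_matrix K N M H Q = 1\<^sub>m M + A * B"
  proof (rule eq_matI)
    fix a b assume "a < dim_row (1\<^sub>m M + A * B)" "b < dim_col (1\<^sub>m M + A * B)"
    then have ab: "a < M" "b < M" using A B by auto
    have "(A * B) $$ (a, b) = (\<Sum>i<R. \<Sum>j<R. cnj (H (i, a)) * ?q i j * H (j, b))"
      using ab by (subst mat_mult_entry[OF A B]) (auto simp: A_def B_def sum_distrib_left mult.assoc)
    also have "\<dots> = (\<Sum>k<K. \<Sum>n<N. \<Sum>n'<N. cnj (H (k * N + n, a)) * ?q (k * N + n) (k * N + n') * H (k * N + n', b))"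
      unfolding R by (rule sum_block_diagonal) (simp add: block_entry_def)
    also have "\<dots> = (\<Sum>k<K. \<Sum>n<N. \<Sum>n'<N. cnj (H (k * N + n, a)) * Q k n n' * H (k * N + n', b))"
      by (intro sum.cong refl) (simp add: block_entry_def)
    finally show "dpc_matrix K N M H Q $$ (a, b) = (1\<^sub>m M + A * B) $$ (a, b)"
      using ab A B by (simp add: dpc_matrix_def)
  qed (use A B in \<open>auto simp: dpc_matrix_def\<close>)
  then have "det (dpc_matrix K N M H Q) = det (1\<^sub>m R + B * A)" using sylvester_det[OF A B] by simp
  \<comment> \<open>In matrix form, \<open>1 + Q G = (G\<^sup>-\<^sup>1 + Q) G\<close>.\<close>
  also have "1\<^sub>m R + B * A = S * ?G"
  proof (rule eq_matI)
    fix i l assume "i < dim_row (S * ?G)" "l < dim_col (S * ?G)"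
    then have il: "i < R" "l < R" using S gram_carrier[of M R ?x] by auto
    have "(B * A) $$ (i, l) = (\<Sum>b<M. (\<Sum>j<R. ?q i j * ?x j b) * cnj (?x l b))"
      using il by (subst mat_mult_entry[OF B A]) (auto simp: A_def B_def)
    also have "\<dots> = dotp M (\<lambda>b. \<Sum>j<R. ?q i j * ?x j b) (?x l)" by (simp add: dotp_def)
    also have "\<dots> = (\<Sum>j<R. ?q i j * dotp M (?x j) (?x l))" by (rule dotp_sum_left)
    finally have BA: "(B * A) $$ (i, l) = (\<Sum>j<R. ?q i j * dotp M (?x j) (?x l))" .
    have "(\<Sum>j<R. dotp M (?z i) (?z j) * dotp M (?x j) (?x l)) = (\<Sum>j<R. dual_coeff M R ?x i j * dotp M (?x j) (?x l))"
      using il by (intro sum.cong) (auto simp: dotp_dual_vec_dual_vec[OF d])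
    also have "\<dots> = dotp M (\<lambda>a. \<Sum>j<R. dual_coeff M R ?x i j * ?x j a) (?x l)" by (rule dotp_sum_left[symmetric])
    also have "\<dots> = dotp M (?z i) (?x l)" unfolding dual_vec_def ..
    also have "\<dots> = (if i = l then 1 else 0)" by (rule dotp_dual_vec[OF d il])
    finally have zz: "(\<Sum>j<R. dotp M (?z i) (?z j) * dotp M (?x j) (?x l)) = (if i = l then 1 else 0)" .
    have "(S * ?G) $$ (i, l) = (\<Sum>j<R. (dotp M (?z i) (?z j) + ?q i j) * dotp M (?x j) (?x l))"
      using il by (subst mat_mult_entry[OF S gram_carrier]) (auto simp: S_def gram_def)
    also have "\<dots> = (if i = l then 1 else 0) + (\<Sum>j<R. ?q i j * dotp M (?x j) (?x l))"
      by (simp only: distrib_right sum.distrib zz)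
    finally show "(1\<^sub>m R + B * A) $$ (i, l) = (S * ?G) $$ (i, l)"
      using il A B BA by simp
  qed (use A B S in \<open>auto simp: gram_def\<close>)
  also have "det \<dots> = det S * det ?G" by (rule det_mult[OF S gram_carrier])
  finally show ?thesis unfolding S_def .
qed

section \<open>Closure properties of positive semidefinite matrices\<close>

lemma psd_hermitian: "psd n A \<Longrightarrow> i < n \<Longrightarrow> j < n \<Longrightarrow> A j i = cnj (A i j)"
  unfolding psd_def by blast

lemma psd_form: "psd n A \<Longrightarrow> 0 \<le> Re (\<Sum>i<n. \<Sum>j<n. cnj (x i) * A i j * x j)"
  unfolding psd_def by blast

lemma psd_add: "psd n A \<Longrightarrow> psd n B \<Longrightarrow> psd n (\<lambda>i j. A i j + B i j)"
proof -
  assume A: "psd n A" and B: "psd n B"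
  show "psd n (\<lambda>i j. A i j + B i j)"
    unfolding psd_def
  proof (intro conjI allI impI)
    show "A j i + B j i = cnj (A i j + B i j)" if "i < n" "j < n" for i j
      using psd_hermitian[OF A that] psd_hermitian[OF B that] by simp
    fix x :: "nat \<Rightarrow> complex"
    have "(\<Sum>i<n. \<Sum>j<n. cnj (x i) * (A i j + B i j) * x j)
      = (\<Sum>i<n. \<Sum>j<n. cnj (x i) * A i j * x j) + (\<Sum>i<n. \<Sum>j<n. cnj (x i) * B i j * x j)"
      by (simp only: distrib_left distrib_right sum.distrib)
    then show "0 \<le> Re (\<Sum>i<n. \<Sum>j<n. cnj (x i) * (A i j + B i j) * x j)"
      using psd_form[OF A, of x] psd_form[OF B, of x] by (simp only: plus_complex.sel add_nonneg_nonneg)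
  qed
qed

lemma psd_cong:
  assumes "\<And>i j. i < n \<Longrightarrow> j < n \<Longrightarrow> A i j = B i j" and A: "psd n A"
  shows "psd n B"
  unfolding psd_def
proof (intro conjI allI impI)
  show "B j i = cnj (B i j)" if "i < n" "j < n" for i j
    using psd_hermitian[OF A that] assms(1) that by metis
  fix x :: "nat \<Rightarrow> complex"
  have "(\<Sum>i<n. \<Sum>j<n. cnj (x i) * B i j * x j) = (\<Sum>i<n. \<Sum>j<n. cnj (x i) * A i j * x j)"
    by (intro sum.cong refl) (simp add: assms(1))
  then show "0 \<le> Re (\<Sum>i<n. \<Sum>j<n. cnj (x i) * B i j * x j)"
    using psd_form[OF A, of x] by (simp only:)
qed

lemma psd_block:
  assumes "\<And>k. k < K \<Longrightarrow> psd N (Q k)"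
  shows "psd (K * N) (block_entry N Q)"
  unfolding psd_def
proof (intro conjI allI impI)
  fix i j assume ij: "i < K * N" "j < K * N"
  then have N: "N > 0" by (cases N) auto
  have "i div N < K" using ij N by (simp add: less_mult_imp_div_less)
  then have "psd N (Q (i div N))" by (rule assms)
  then show "block_entry N Q j i = cnj (block_entry N Q i j)"
    using N psd_hermitian[of N "Q (i div N)" "i mod N" "j mod N"] by (simp add: block_entry_def)
next
  fix x :: "nat \<Rightarrow> complex"
  have "(\<Sum>i<K * N. \<Sum>j<K * N. cnj (x i) * block_entry N Q i j * x j)
    = (\<Sum>k<K. \<Sum>n<N. \<Sum>n'<N. cnj (x (k * N + n)) * block_entry N Q (k * N + n) (k * N + n') * x (k * N + n'))"
    by (rule sum_block_diagonal) (simp add: block_entry_def)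
  also have "\<dots> = (\<Sum>k<K. \<Sum>n<N. \<Sum>n'<N. cnj (x (k * N + n)) * Q k n n' * x (k * N + n'))"
    by (intro sum.cong refl) (simp add: block_entry_def)
  finally have "Re (\<Sum>i<K * N. \<Sum>j<K * N. cnj (x i) * block_entry N Q i j * x j)
    = (\<Sum>k<K. Re (\<Sum>n<N. \<Sum>n'<N. cnj (x (k * N + n)) * Q k n n' * x (k * N + n')))"
    by (simp only: Re_sum)
  also have "\<dots> \<ge> 0"
    using assms by (intro sum_nonneg psd_form) auto
  finally show "0 \<le> Re (\<Sum>i<K * N. \<Sum>j<K * N. cnj (x i) * block_entry N Q i j * x j)" .
qed

lemma C_DPC_limit:
  assumes R: "R = K * N" "R > 0" "R \<le> M" and pos: "gdet M R (curry H) > 0"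
  shows "((\<lambda>P. C_DPC K N M H P - R * log 2 (P / R)) \<longlongrightarrow> log 2 (gdet M R (curry H))) at_top"
proof -
  let ?x = "curry H"
  let ?g = "gdet M R ?x" and ?z = "dual_vec M R ?x"
  have d: "det (gram M R ?x) \<noteq> 0" using pos R by (simp add: det_gram_real)
  \<comment> \<open>The trace of the inverse Gram matrix; the trace of \<open>S Q\<close> is at most
    \<open>D + P\<close> for every feasible \<open>Q\<close>.\<close>
  define D where "D = Re (\<Sum>i<R. dotp M (?z i) (?z i))"
  define F where "F P = {Q. (\<forall>k<K. psd N (Q k)) \<and> Re (\<Sum>k<K. \<Sum>n<N. Q k n n) \<le> P}" for P
  define S where "S Q = mat R R (\<lambda>(i, j). dotp M (?z i) (?z j) + block_entry N Q i j)" for Q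
  have Sc: "S Q \<in> carrier_mat R R" for Q by (simp add: S_def)
  have C: "C_DPC K N M H P = Sup ((\<lambda>Q. log 2 (Re (det (dpc_matrix K N M H Q)))) ` F P)" for P
    unfolding C_DPC_def F_def by (rule arg_cong[where f = Sup]) auto
  have det: "Re (det (dpc_matrix K N M H Q)) = Re (det (S Q)) * ?g" for Q
    using det_dpc_matrix[OF R(1) d, of Q] R by (simp add: S_def det_gram_real)
  have bound: "log 2 (Re (det (dpc_matrix K N M H Q))) \<le> log 2 ?g + R * log 2 ((D + P) / R)"
    if Q: "Q \<in> F P" and nonneg: "log 2 ?g + R * log 2 ((D + P) / R) \<ge> 0" for Q P
  proof -
    have "psd R (\<lambda>i j. dotp M (?z i) (?z j) + block_entry N Q i j)"
      using Q unfolding R F_def by (intro psd_add gram_psd psd_block) auto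
    then have psd: "psd R (\<lambda>i j. S Q $$ (i, j))" by (rule psd_cong[rotated]) (simp add: S_def)
    have "(\<Sum>i<R. S Q $$ (i, i)) = (\<Sum>i<R. dotp M (?z i) (?z i)) + (\<Sum>i<R. block_entry N Q i i)"
      by (simp add: S_def sum.distrib)
    also have "(\<Sum>i<R. block_entry N Q i i) = (\<Sum>k<K. \<Sum>n<N. Q k n n)"
      unfolding R sum_blocks[symmetric] by (intro sum.cong refl) (simp add: block_entry_def)
    finally have "Re (\<Sum>i<R. S Q $$ (i, i)) = D + Re (\<Sum>k<K. \<Sum>n<N. Q k n n)"
      by (simp only: D_def plus_complex.sel)
    moreover have "Re (\<Sum>k<K. \<Sum>n<N. Q k n n) \<le> P" using Q unfolding F_def by blast
    ultimately have tr: "Re (\<Sum>i<R. S Q $$ (i, i)) \<le> D + P" by linarith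
    \<comment> \<open>Testing the form on unit vectors gives nonnegative diagonal entries. A
      nonnegative trace is what makes raising the trace bound to the power \<open>R\<close>
      monotone.\<close>
    have tr0: "Re (\<Sum>i<R. S Q $$ (i, i)) \<ge> 0"
    proof -
      have "Re (S Q $$ (i, i)) \<ge> 0" if "i < R" for i
      proof -
        have "0 \<le> Re (\<Sum>k<R. \<Sum>j<R. cnj (if k = i then 1 else 0) * S Q $$ (k, j) * (if j = i then 1 else 0))"
          by (rule psd_form[OF psd])
        also have "(\<Sum>k<R. \<Sum>j<R. cnj (if k = i then 1 else 0) * S Q $$ (k, j) * (if j = i then 1 else 0))
          = (\<Sum>k<R. if k = i then S Q $$ (i, i) else 0)"
          using that by (intro sum.cong refl) (auto simp: if_distrib[of "\<lambda>x. _ * x"] cong: if_cong)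
        finally show ?thesis using that by simp
      qed
      then show ?thesis unfolding Re_sum by (intro sum_nonneg) auto
    qed
    note det0 = psd_det_le[OF Sc psd R(2)]
    show ?thesis
    proof (cases "Re (det (S Q)) = 0")
      case True
      \<comment> \<open>Junk value: \<open>log 2 0 = 0\<close>, hence the hypothesis \<open>nonneg\<close>.\<close>
      then have "log 2 (Re (det (dpc_matrix K N M H Q))) = 0" unfolding det by (simp add: log_def)
      then show ?thesis using nonneg by simp
    next
      case False
      then have p: "Re (det (S Q)) > 0" using det0(1) by simp
      have le: "Re (det (S Q)) \<le> ((D + P) / R) ^ R"
        using det0(2) tr tr0 R by (elim order_trans) (intro power_mono divide_right_mono, auto)
      \<comment> \<open>With \<open>D + P = 0\<close> the AM-GM bound would force the determinant to
        vanish.\<close>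
      have DP: "D + P > 0"
      proof (rule ccontr)
        assume "\<not> D + P > 0"
        then have "D + P = 0" using tr tr0 by simp
        then show False using le p R(2) by (simp add: power_0_left)
      qed
      have "log 2 (Re (det (dpc_matrix K N M H Q))) = log 2 (Re (det (S Q))) + log 2 ?g"
        using p pos by (simp add: det log_mult)
      also have "\<dots> \<le> log 2 (((D + P) / R) ^ R) + log 2 ?g" using p le by simp
      also have "log 2 (((D + P) / R) ^ R) = R * log 2 ((D + P) / R)" using DP R(2) by (simp add: log_nat_power)
      finally show ?thesis by (simp only: add.commute)
    qed
  qed
  \<comment> \<open>\<open>S\<close> at the equal power allocation \<open>Q0 t\<close>, divided by
    \<open>t\<close>. It tends to the identity matrix, so the determinant of \<open>S\<close> grows
    like \<open>t ^ R\<close>.\<close>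
  define E where "E t = mat R R (\<lambda>(i, j). dotp M (?z i) (?z j) / of_real t + (if i = j then 1 else 0))" for t :: real
  define Q0 where "Q0 t = (\<lambda>(k::nat) (n::nat) (n'::nat). if n = n' then complex_of_real t else 0)" for t
  have Q0_F: "Q0 (P / R) \<in> F P" if "P > 0" for P
  proof -
    have "psd N (Q0 (P / R) k)" for k
      unfolding psd_def
    proof (intro conjI allI impI)
      fix x :: "nat \<Rightarrow> complex"
      have "(\<Sum>i<N. \<Sum>j<N. cnj (x i) * Q0 (P / R) k i j * x j) = (\<Sum>i<N. of_real (P / R) * (x i * cnj (x i)))"
        by (intro sum.cong refl) (simp add: Q0_def if_distrib[of "\<lambda>x. _ * x"] if_distrib[of "\<lambda>x. x * _"] mult_ac cong: if_cong)
      also have "\<dots> = of_real (\<Sum>i<N. (P / R) * (cmod (x i))\<^sup>2)"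
        by (simp only: of_real_sum of_real_mult complex_norm_square)
      finally show "0 \<le> Re (\<Sum>i<N. \<Sum>j<N. cnj (x i) * Q0 (P / R) k i j * x j)"
        using that by (simp only: Re_complex_of_real) (simp add: sum_nonneg)
    qed (simp add: Q0_def)
    moreover have "(\<Sum>k<K. \<Sum>n<N. Q0 (P / R) k n n) = of_real P"
      using R by (simp add: Q0_def)
    ultimately show ?thesis unfolding F_def by (simp only: mem_Collect_eq Re_complex_of_real) simp
  qed
  have S_Q0: "det (S (Q0 t)) = of_real t ^ R * det (E t)" if "t > 0" for t
  proof -
    have ent: "block_entry N (Q0 t) i j = (if i = j then of_real t else 0)" for i j
      unfolding block_entry_def Q0_def by auto (metis div_mult_mod_eq)
    have "S (Q0 t) = of_real t \<cdot>\<^sub>m E t"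
      using that by (intro eq_matI) (auto simp: S_def E_def ent field_simps)
    then show ?thesis by (simp add: E_def)
  qed
  define L where "L P = log 2 (Re (det (dpc_matrix K N M H (Q0 (P / R)))))" for P
  have E_lim: "((\<lambda>P. Re (det (E (P / R)))) \<longlongrightarrow> 1) at_top"
  proof -
    have "((\<lambda>P. det (E (P / R))) \<longlongrightarrow> det (mat R R (\<lambda>(i, j). if i = j then 1 else 0))) at_top"
      unfolding E_def
    proof (rule tendsto_det)
      fix i j
      have "((\<lambda>P. 1 / (P / R)) \<longlongrightarrow> 0) at_top" using R(2) by real_asymp
      then have "((\<lambda>P. complex_of_real (1 / (P / R))) \<longlongrightarrow> of_real 0) at_top"
        by (rule tendsto_of_real)
      then have "((\<lambda>P. dotp M (?z i) (?z j) * complex_of_real (1 / (P / R)) + (if i = j then 1 else 0))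
        \<longlongrightarrow> dotp M (?z i) (?z j) * of_real 0 + (if i = j then 1 else 0)) at_top"
        by (intro tendsto_add tendsto_mult tendsto_const)
      then show "((\<lambda>P. dotp M (?z i) (?z j) / complex_of_real (P / R) + (if i = j then 1 else 0))
        \<longlongrightarrow> (if i = j then 1 else 0)) at_top" by simp
    qed
    moreover have "mat R R (\<lambda>(i, j). if i = j then 1 else 0) = (1\<^sub>m R :: complex mat)" by (auto intro: eq_matI)
    ultimately show ?thesis using tendsto_Re by fastforce
  qed
  show ?thesis
  proof (rule capacity_limit[where L = L and D = D])
    show "real R > 0" using R(2) by simp
    note nn = capacity_bound_nonneg[OF \<open>real R > 0\<close>, of "log 2 ?g" D]
    show "\<forall>\<^sub>F P in at_top. C_DPC K N M H P \<le> log 2 ?g + R * log 2 ((D + P) / R)"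
      using nn eventually_gt_at_top[of 0]
      by eventually_elim (unfold C, intro cSup_least, use Q0_F bound in auto)
    show "\<forall>\<^sub>F P in at_top. L P \<le> C_DPC K N M H P"
      using nn eventually_gt_at_top[of 0]
    proof eventually_elim
      case (elim P)
      then show ?case
        unfolding C L_def by (intro cSup_upper imageI Q0_F bdd_aboveI2[of _ _ "log 2 ?g + R * log 2 ((D + P) / R)"] bound)
    qed
    have "((\<lambda>P. log 2 ?g + log 2 (Re (det (E (P / R))))) \<longlongrightarrow> log 2 ?g + log 2 1) at_top"
      by (intro tendsto_intros E_lim) auto
    moreover have "\<forall>\<^sub>F P in at_top. log 2 ?g + log 2 (Re (det (E (P / R)))) = L P - R * log 2 (P / R)"
      using order_tendstoD(1)[OF E_lim, of 0, simplified] eventually_gt_at_top[of 0]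
    proof eventually_elim
      case (elim P)
      have "P / R > 0" using elim R(2) by simp
      moreover have "Re (of_real (P / R) ^ R * det (E (P / R))) = (P / R) ^ R * Re (det (E (P / R)))"
        by (simp only: of_real_power[symmetric] Re_complex_of_real times_complex.sel Im_complex_of_real mult_zero_left diff_zero)
      ultimately have "L P = log 2 ((P / R) ^ R * Re (det (E (P / R))) * ?g)"
        unfolding L_def det by (subst S_Q0) auto
      also have "\<dots> = R * log 2 (P / R) + log 2 (Re (det (E (P / R)))) + log 2 ?g"
        using \<open>P / R > 0\<close> elim pos by (simp add: log_mult log_nat_power)
      finally show ?case by simp
    qed
    ultimately show "((\<lambda>P. L P - R * log 2 (P / R)) \<longlongrightarrow> log 2 ?g) at_top"
      by (simp add: tendsto_cong)
  qed
qed

lemma C_ZF_limit: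
  assumes R: "R = K * N" "R > 0" and g: "\<And>i. i < R \<Longrightarrow> (zf_gain R M H i)\<^sup>2 > 0"
  shows "((\<lambda>P. C_ZF K N M H P - R * log 2 (P / R)) \<longlongrightarrow> (\<Sum>i<R. log 2 ((zf_gain R M H i)\<^sup>2))) at_top"
proof -
  define w where "w i = (zf_gain R M H i)\<^sup>2" for i
  have w: "w i > 0" if "i < R" for i using g that by (simp add: w_def)
  \<comment> \<open>From \<open>1 + p * w = w * (1 / w + p)\<close>: AM-GM is applied to the numbers
    \<open>1 / w i + p i\<close>, whose sum is at most \<open>D + P\<close>.\<close>
  define D where "D = (\<Sum>i<R. 1 / w i)"
  define F where "F P = {Pw. (\<forall>k<K. \<forall>n<N. 0 \<le> Pw k n) \<and> (\<Sum>k<K. \<Sum>n<N. Pw k n) \<le> P}" for P :: real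
  define rate where "rate Pw = (\<Sum>k<K. \<Sum>n<N. log 2 (1 + Pw k n * w (k * N + n)))" for Pw
  have C: "C_ZF K N M H P = Sup (rate ` F P)" for P
    unfolding C_ZF_def F_def rate_def w_def R by (rule arg_cong[where f = Sup]) auto
  have bound: "rate Pw \<le> (\<Sum>i<R. log 2 (w i)) + R * log 2 ((D + P) / R)" if Pw: "Pw \<in> F P" for Pw P
  proof -
    have N: "N > 0" using R by (cases N) auto
    define p where "p i = Pw (i div N) (i mod N)" for i
    have p: "p i \<ge> 0" if "i < R" for i
      using that Pw N unfolding p_def F_def R by (auto simp: less_mult_imp_div_less)
    have "(\<Sum>i<R. p i) = (\<Sum>k<K. \<Sum>n<N. Pw k n)"
      unfolding R sum_blocks[symmetric] by (intro sum.cong refl) (simp add: p_def)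
    then have sp: "(\<Sum>i<R. p i) \<le> P" using Pw by (simp add: F_def)
    have pw: "1 / w i + p i > 0" if "i < R" for i using w[OF that] p[OF that] by (simp add: add_pos_nonneg)
    have ne: "{..<R} \<noteq> {}" using R(2) by auto
    have s: "(\<Sum>i<R. 1 / w i + p i) > 0" "(\<Sum>i<R. 1 / w i + p i) \<le> D + P"
    proof -
      show "(\<Sum>i<R. 1 / w i + p i) > 0" using pw ne by (intro sum_pos) auto
      show "(\<Sum>i<R. 1 / w i + p i) \<le> D + P" using sp by (simp add: D_def sum.distrib)
    qed
    have "rate Pw = (\<Sum>i<R. log 2 (1 + p i * w i))"
      unfolding R sum_blocks[symmetric] rate_def by (intro sum.cong refl) (simp add: p_def)
    also have "\<dots> = (\<Sum>i<R. log 2 (w i) + log 2 (1 / w i + p i))"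
    proof (intro sum.cong refl)
      fix i assume "i \<in> {..<R}"
      then have i: "i < R" by simp
      have "1 + p i * w i = w i * (1 / w i + p i)" using w[OF i] by (simp add: field_simps)
      then show "log 2 (1 + p i * w i) = log 2 (w i) + log 2 (1 / w i + p i)"
        using w[OF i] pw[OF i] by (simp add: log_mult)
    qed
    also have "\<dots> = (\<Sum>i<R. log 2 (w i)) + log 2 (\<Prod>i<R. 1 / w i + p i)"
    proof -
      have "ln (\<Prod>i<R. 1 / w i + p i) = (\<Sum>i<R. ln (1 / w i + p i))"
        using pw by (intro ln_prod) (force simp: less_le)+
      then show ?thesis by (simp add: sum.distrib log_def sum_divide_distrib)
    qed
    also have "log 2 (\<Prod>i<R. 1 / w i + p i) \<le> log 2 (((D + P) / R) ^ R)"
    proof -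
      have "(\<Prod>i<R. 1 / w i + p i) \<le> ((\<Sum>i<R. 1 / w i + p i) / R) ^ R"
        using am_gm[of "{..<R}" "\<lambda>i. 1 / w i + p i"] ne pw by (simp add: less_imp_le)
      also have "\<dots> \<le> ((D + P) / R) ^ R"
        using s by (intro power_mono divide_right_mono) simp_all
      finally show ?thesis using pw by (intro log_mono) (auto intro!: prod_pos)
    qed
    also have "log 2 (((D + P) / R) ^ R) = R * log 2 ((D + P) / R)"
      using R(2) s by (simp add: log_nat_power)
    finally show ?thesis by simp
  qed
  have F0: "(\<lambda>_ _. P / R) \<in> F P" if "P > 0" for P
    using that R by (simp add: F_def)
  define L where "L P = rate (\<lambda>_ _. P / R)" for P
  have "((\<lambda>P. C_ZF K N M H P - R * log 2 (P / R)) \<longlongrightarrow> (\<Sum>i<R. log 2 (w i))) at_top"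
  proof (rule capacity_limit[where L = L and D = D])
    show "real R > 0" using R(2) by simp
    show "\<forall>\<^sub>F P in at_top. C_ZF K N M H P \<le> (\<Sum>i<R. log 2 (w i)) + R * log 2 ((D + P) / R)"
      using eventually_gt_at_top[of 0]
      by eventually_elim (unfold C, intro cSup_least, use F0 bound in auto)
    show "\<forall>\<^sub>F P in at_top. L P \<le> C_ZF K N M H P"
      using eventually_gt_at_top[of 0]
    proof eventually_elim
      case (elim P)
      then show ?case
        unfolding C L_def
        by (intro cSup_upper imageI F0 bdd_aboveI2[of _ _ "(\<Sum>i<R. log 2 (w i)) + R * log 2 ((D + P) / R)"] bound)
    qed
    have inv: "((\<lambda>P. 1 / (P / R)) \<longlongrightarrow> 0) at_top" using R(2) by real_asymp
    have "((\<lambda>P. \<Sum>i<R. log 2 (1 / (P / R) + w i)) \<longlongrightarrow> (\<Sum>i<R. log 2 (0 + w i))) at_top"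
      using w by (intro tendsto_intros inv) (auto simp: less_imp_neq[symmetric])
    moreover have "\<forall>\<^sub>F P in at_top. (\<Sum>i<R. log 2 (1 / (P / R) + w i)) = L P - R * log 2 (P / R)"
      using eventually_gt_at_top[of 0]
    proof eventually_elim
      case (elim P)
      define t where "t = P / R"
      have t: "t > 0" using elim R(2) by (simp add: t_def)
      have "L P = (\<Sum>i<R. log 2 (1 + t * w i))"
        unfolding R sum_blocks[symmetric] L_def rate_def t_def by simp
      also have "\<dots> = (\<Sum>i<R. log 2 t + log 2 (1 / t + w i))"
      proof (intro sum.cong refl)
        fix i assume "i \<in> {..<R}"
        then have i: "w i > 0" using w by simp
        have "1 + t * w i = t * (1 / t + w i)" using t by (simp add: field_simps)
        then show "log 2 (1 + t * w i) = log 2 t + log 2 (1 / t + w i)"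
          using t i add_pos_pos[of "1 / t" "w i"] by (simp only: log_mult) simp
      qed
      finally show ?case by (simp add: sum.distrib t_def)
    qed
    ultimately show "((\<lambda>P. L P - R * log 2 (P / R)) \<longlongrightarrow> (\<Sum>i<R. log 2 (w i))) at_top"
      by (simp add: tendsto_cong)
  qed
  then show ?thesis by (simp add: w_def)
qed

subsection \<open>The expected rate gap\<close>

text \<open>Rows are independent and identically distributed, so selecting \<open>m\<close> of them
  along an injection reproduces the law of \<open>m\<close> rows. With \<open>skip i\<close> for
  \<open>\<rho>\<close> this covers the Gram determinant without row \<open>i\<close>.\<close>

lemma expectation_ln_gdet_reindex:
  assumes m: "m \<le> M" and \<rho>: "inj_on \<rho> {..<m}" "\<rho> ` {..<m} \<subseteq> {..<R}"
  shows "has_bochner_integral (gauss_mat {..<R} M) (\<lambda>H. ln (gdet M m (curry H \<circ> \<rho>))) (\<Sum>j<m. erlang_ln (M - j - 1))"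
    and "AE H in gauss_mat {..<R} M. gdet M m (curry H \<circ> \<rho>) > 0"
proof -
  let ?f = "\<lambda>H. \<lambda>p\<in>{..<m} \<times> {..<M}. H ((\<lambda>(j, a). (\<rho> j, a)) p) :: complex"
  have reindex: "distr (gauss_mat {..<R} M) (gauss_mat {..<m} M) ?f = gauss_mat {..<m} M"
    unfolding gauss_mat_def
    by (rule distr_PiM_reindex) (use \<rho> prob_space_complex_gaussian in \<open>auto simp: inj_on_def\<close>)
  have f: "?f \<in> measurable (gauss_mat {..<R} M) (gauss_mat {..<m} M)"
    unfolding gauss_mat_def by (intro measurable_restrict measurable_component_singleton) (use \<rho> in auto)
  have eq: "gdet M m (curry (?f H)) = gdet M m (curry H \<circ> \<rho>)" for H
  proof -
    have "gram M m (curry (?f H)) = gram M m (curry H \<circ> \<rho>)" by (rule gram_cong) auto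
    then show ?thesis by (simp only: gdet_def)
  qed
  note law = expectation_ln_gdet[OF m]
  note [measurable] = gdet_curry_measurable
  have "has_bochner_integral (distr (gauss_mat {..<R} M) (gauss_mat {..<m} M) ?f)
      (\<lambda>H. ln (gdet M m (curry H))) (\<Sum>j<m. erlang_ln (M - j - 1))"
    unfolding reindex using law by blast
  then have "has_bochner_integral (gauss_mat {..<R} M) (\<lambda>H. ln (gdet M m (curry (?f H)))) (\<Sum>j<m. erlang_ln (M - j - 1))"
    by (rule has_bochner_integral_distr_iff[OF _ f, THEN iffD1, rotated]) measurable
  then show "has_bochner_integral (gauss_mat {..<R} M) (\<lambda>H. ln (gdet M m (curry H \<circ> \<rho>))) (\<Sum>j<m. erlang_ln (M - j - 1))"
    by (simp only: eq)
  have "AE H in distr (gauss_mat {..<R} M) (gauss_mat {..<m} M) ?f. gdet M m (curry H) > 0"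
    unfolding reindex using law by blast
  then have "AE H in gauss_mat {..<R} M. gdet M m (curry (?f H)) > 0"
    by (rule AE_distrD[OF f])
  then show "AE H in gauss_mat {..<R} M. gdet M m (curry H \<circ> \<rho>) > 0"
    by (simp only: eq)
qed

text \<open>In digamma terms the left side is the sum over j < R of \<psi>(M - j) - \<psi>(M - R +
  1). Passing to R + 1 lowers the reference value by 1 / (M - R) in each of the R old summands, and
  the new summand is zero.\<close>

lemma sum_erlang_ln:
  assumes "R \<ge> 1" "R \<le> M"
  shows "(\<Sum>j<R. erlang_ln (M - j - 1)) - real R * erlang_ln (M - R) = (\<Sum>j = 1..R - 1. real j / (real M - real j))"
  using assms
proof (induction R rule: dec_induct)
  case base
  then show ?case by simp
next
  case (step R)
  have "M - R = Suc (M - Suc R)" using step.prems by simp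
  then have "erlang_ln (M - R) = erlang_ln (M - Suc R) + 1 / real (M - R)"
    using erlang_ln_Suc[of "M - Suc R"] by simp
  moreover have "real (M - R) = real M - real R" using step.prems by simp
  ultimately have e: "erlang_ln (M - R) = erlang_ln (M - Suc R) + 1 / (real M - real R)" by simp
  have "(\<Sum>j = 1..Suc R - 1. real j / (real M - real j)) = (\<Sum>j = 1..R - 1. real j / (real M - real j)) + real R / (real M - real R)"
    using step.hyps by (cases R) auto
  then show ?case using step.IH step.prems e by (simp add: algebra_simps)
qed

theorem theorem2:
  fixes K N M :: nat
  assumes "K \<ge> 1" and "N \<ge> 1" and "M \<ge> K * N"
  shows "\<exists>\<beta> :: (nat \<times> nat \<Rightarrow> complex) \<Rightarrow> real.
    (AE H in channel_distr K N M.
       ((\<lambda>P. C_DPC K N M H P - C_ZF K N M H P) \<longlongrightarrow> \<beta> H) at_top) \<and>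
    has_bochner_integral (channel_distr K N M) \<beta>
      (log 2 (exp 1) * (\<Sum>j = 1..K * N - 1. real j / (real M - real j)))"
proof -
  define R where "R = K * N"
  have R: "R = K * N" "R > 0" "R \<le> M" using assms by (auto simp: R_def)
  define full where "full H = gdet M R (curry H)" for H
  define minor where "minor i H = gdet M (R - 1) (curry H \<circ> skip i)" for i H
  \<comment> \<open>A formula in Gram determinants, defined for every \<open>H\<close>, which makes
    integrability a matter of their logarithms. It is the limit wherever all these determinants are
    positive.\<close>
  define \<beta> where "\<beta> H = log 2 (full H) - (\<Sum>i<R. log 2 (full H) - log 2 (minor i H))" for H
  have chan: "channel_distr K N M = gauss_mat {..<R} M"
    by (simp add: channel_distr_def gauss_mat_def R_def)
  have skip: "inj_on (skip i) {..<R - 1}" "skip i ` {..<R - 1} \<subseteq> {..<R}" for i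
    by (auto simp: inj_on_def skip_def split: if_splits)
  have full: "has_bochner_integral (gauss_mat {..<R} M) (\<lambda>H. ln (full H)) (\<Sum>j<R. erlang_ln (M - j - 1))"
    "AE H in gauss_mat {..<R} M. full H > 0"
    unfolding full_def using expectation_ln_gdet[OF R(3)] by blast+
  have minor: "has_bochner_integral (gauss_mat {..<R} M) (\<lambda>H. ln (minor i H)) (\<Sum>j<R - 1. erlang_ln (M - j - 1))"
    "AE H in gauss_mat {..<R} M. minor i H > 0" for i
    unfolding minor_def using expectation_ln_gdet_reindex[OF _ skip, of M i] R(3) by auto
  have "AE H in gauss_mat {..<R} M. \<forall>i\<in>{..<R}. minor i H > 0"
    by (rule AE_finite_allI) (auto intro: minor)
  then have "AE H in channel_distr K N M. ((\<lambda>P. C_DPC K N M H P - C_ZF K N M H P) \<longlongrightarrow> \<beta> H) at_top"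
    unfolding chan using full(2)
  proof eventually_elim
    case (elim H)
    have gain: "(zf_gain R M H i)\<^sup>2 = full H / minor i H" if "i < R" for i
      using elim that unfolding full_def minor_def by (intro zf_gain_square R) auto
    have "((\<lambda>P. C_DPC K N M H P - R * log 2 (P / R)) \<longlongrightarrow> log 2 (full H)) at_top"
      using elim unfolding full_def by (intro C_DPC_limit R) auto
    moreover have "((\<lambda>P. C_ZF K N M H P - R * log 2 (P / R)) \<longlongrightarrow> (\<Sum>i<R. log 2 ((zf_gain R M H i)\<^sup>2))) at_top"
      using elim by (intro C_ZF_limit R) (simp add: gain)
    \<comment> \<open>Both capacities were centred by the same \<open>R * log 2 (P / R)\<close>,
      which cancels in the difference.\<close>
    ultimately have "((\<lambda>P. (C_DPC K N M H P - R * log 2 (P / R)) - (C_ZF K N M H P - R * log 2 (P / R)))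
      \<longlongrightarrow> log 2 (full H) - (\<Sum>i<R. log 2 ((zf_gain R M H i)\<^sup>2))) at_top"
      by (rule tendsto_diff)
    moreover have "(\<Sum>i<R. log 2 ((zf_gain R M H i)\<^sup>2)) = (\<Sum>i<R. log 2 (full H) - log 2 (minor i H))"
    proof (intro sum.cong refl)
      fix i assume i: "i \<in> {..<R}"
      then have "minor i H \<noteq> 0" using elim by force
      then show "log 2 ((zf_gain R M H i)\<^sup>2) = log 2 (full H) - log 2 (minor i H)"
        using i elim(2) by (simp add: gain log_divide)
    qed
    ultimately show ?case by (simp add: \<beta>_def)
  qed
  moreover have "has_bochner_integral (gauss_mat {..<R} M) \<beta>
      (log 2 (exp 1) * (\<Sum>j = 1..R - 1. real j / (real M - real j)))"
  proof -
    let ?s = "\<lambda>m. \<Sum>j<m. erlang_ln (M - j - 1)"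
    have "has_bochner_integral (gauss_mat {..<R} M)
      (\<lambda>H. (ln (full H) - (\<Sum>i<R. ln (full H) - ln (minor i H))) / ln 2)
      ((?s R - (\<Sum>i<R. ?s R - ?s (R - 1))) / ln 2)"
      by (intro has_bochner_integral_divide_zero has_bochner_integral_diff has_bochner_integral_sum full minor)
    also have "(\<lambda>H. (ln (full H) - (\<Sum>i<R. ln (full H) - ln (minor i H))) / ln 2) = \<beta>"
      by (intro ext) (simp add: \<beta>_def log_def diff_divide_distrib sum_divide_distrib)
    also have "(?s R - (\<Sum>i<R. ?s R - ?s (R - 1))) / ln 2
      = log 2 (exp 1) * (\<Sum>j = 1..R - 1. real j / (real M - real j))"
    proof -
      \<comment> \<open>\<open>erlang_ln (M - R)\<close> is the mean logarithm of a squared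
        zero-forcing gain, the same for each of the \<open>R\<close> rows.\<close>
      have "?s R = ?s (R - 1) + erlang_ln (M - R)"
        using R(2) by (cases R) auto
      then have "?s R - (\<Sum>i<R. ?s R - ?s (R - 1)) = ?s R - real R * erlang_ln (M - R)" by simp
      also have "\<dots> = (\<Sum>j = 1..R - 1. real j / (real M - real j))"
        using R(2,3) by (intro sum_erlang_ln) auto
      finally show ?thesis by (simp add: log_def)
    qed
    finally show ?thesis .
  qed
  ultimately show ?thesis unfolding chan R_def[symmetric] by blast
qed

end
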